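(* Consider the mixture with varying concentrations model, the moment functions $g_1,\dots,g_K$, the vector of functional moments $\bar g\in\mathbb{R}^d$, a measurable function $T:\mathbb{R}^d\to\mathbb{R}^L$, and, for $\alpha\in(0,1)$, the test $\pi_{N,\alpha}$ of the hypothesis $H_0:\ T(\bar g)=\mathbb{O}_L$, all as described in the context. Assume that: (a) the derivative $T'(\bar g)\in\mathbb{R}^{L\times d}$ of $T$ at $\bar g$ exists; (b) the moments $\bar g_k^m=\mathsf{E}[g_k(\eta_m)]$ and $\bar g_{k,l}^m=\mathsf{E}[g_k(\eta_m)g_l(\eta_m)^T]$ exist and are finite for all $k,l=1,\dots,K$, $m=1,\dots,M$; there exists $\delta>0$ such that $\mathsf{E}\left[|g_k(\eta_m)|^{2+\delta}\right]<\infty$ for all $k=1,\dots,K$, $m=1,\dots,M$; and the matrices $\Gamma$, $\Gamma^{-1}$, $\alpha_{r,s}$, $\beta_m$ (limits defined in the context) exist and are finite for all $r,s,m=1,\dots,M$; (c) the matrix $D:=T'(\bar g)\,\Sigma\,(T'(\bar g))^T$ is nonsingular, where $\Sigma$ is the matrix defined in the context; (d) the estimators used in the construction of the test are consistent, i.e. $\tilde g_N\to\bar g$, $\tilde g_{k;N}^m\to\bar g_k^m$ and $\tilde g_{k,l;N}^m\to\bar g_{k,l}^m$ in probability as $N\to\infty$ for all $k,l=1,\dots,K$, $m=1,\dots,M$; (e) $T'$ is continuous in some neighborhood of $\bar g$. Then, under $H_0$ (that is, when $T(\bar g)=\mathbb{O}_L$), $$\lim_{N\to\infty}\mathsf{P}_{H_0}\{\pi_{N,\alpha}\text{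 rejects }H_0\}=\alpha.$$
   Context: Model. Let $M\ge1$ and let $F_1,\dots,F_M$ be probability distributions on a measurable space $(\mathfrak X,\mathfrak F)$; $\eta_m$ denotes a random element with distribution $F_m$. For each $N\ge 1$ let $p_{j;N}^m$ ($j=1,\dots,N$, $m=1,\dots,M$) be nonrandom numbers (concentrations) with $p_{j;N}^m\ge 0$ and $\sum_{m=1}^M p_{j;N}^m=1$. For each $N$ the observations $\xi_{1;N},\dots,\xi_{N;N}$ are independent random elements of $\mathfrak X$ with $\mathsf{P}[\xi_{j;N}\in A]=\sum_{m=1}^M p_{j;N}^m F_m(A)$, $A\in\mathfrak F$. Averages. $\langle u_{\cdot;N}\rangle_N:=\frac1N\sum_{j=1}^N u_{j;N}$; products inside brackets are taken componentwise in $j$. Weights. $\Gamma_N:=(\langle p^m_{\cdot;N}p^i_{\cdot;N}\rangle_N)_{m,i=1}^M$ and $\Gamma:=\lim_{N\to\infty}\Gamma_N$. For $N$ with $\Gamma_N$ nonsingular (all sufficiently large $N$ when $\Gamma$ exists and is invertible), $a_{j;N}^m:=\sum_{i=1}^M p_{j;N}^i(\Gamma_N^{-1})_{i,m}$. Moments and estimators. Let $K\le M$ and let $g_k:\mathfrak X\to\mathbb{R}^{d_k}$, $k=1,\dots,K$, be measurable; $d:=d_1+\dots+d_K$. Put $\bar g_k^m:=\mathsf{E}[g_k(\eta_m)]$, $\bar g_{k,l}^m:=\mathsf{E}[g_k(\eta_m)g_l(\eta_m)^T]$, $\hat g_{k;N}^m:=\frac1N\sum_{j=1}^N a_{j;N}^m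 g_k(\xi_{j;N})$, and $$\bar g:=\left((\bar g_1^1)^T,\dots,(\bar g_K^K)^T\right)^T\in\mathbb{R}^d,\qquad \hat g_N:=\left((\hat g_{1;N}^1)^T,\dots,(\hat g_{K;N}^K)^T\right)^T\in\mathbb{R}^d.$$ The measurable function $T:\mathbb{R}^{d_1}\times\dots\times\mathbb{R}^{d_K}\to\mathbb{R}^L$ is regarded as a function on $\mathbb{R}^d$, $T'(y)=\left(\frac{\partial}{\partial y_1}T(y),\dots,\frac{\partial}{\partial y_d}T(y)\right)\in\mathbb{R}^{L\times d}$ is its derivative (Jacobian matrix), and $\hat T_N:=T(\hat g_N)$. "$T'(y)$ exists" means $T$ is (totally) differentiable at $y$. $\mathbb{O}_L$ is the zero vector of $\mathbb{R}^L$. Matrices. For $r,s,m=1,\dots,M$ and $k,l=1,\dots,K$: $\alpha_{r,s;N}^{k,l}:=\langle a^k_{\cdot;N}a^l_{\cdot;N}p^r_{\cdot;N}p^s_{\cdot;N}\rangle_N$, $\beta_{m;N}^{k,l}:=\langle a^k_{\cdot;N}a^l_{\cdot;N}p^m_{\cdot;N}\rangle_N$, $\alpha_{r,s}^{k,l}:=\lim_{N\to\infty}\alpha_{r,s;N}^{k,l}$, $\beta_m^{k,l}:=\lim_{N\to\infty}\beta_{m;N}^{k,l}$, $\alpha_{r,s}:=(\alpha_{r,s}^{k,l})_{k,l=1}^K$, $\beta_m:=(\beta_m^{k,l})_{k,l=1}^K$. The matrix $\Sigma=(\Sigma^{(k,l)})_{k,l=1}^K\in\mathbb{R}^{d\times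 d}$ has blocks $$\Sigma^{(k,l)}:=\sum_{m=1}^M\beta_m^{k,l}\,\bar g_{k,l}^m-\sum_{r,s=1}^M\alpha_{r,s}^{k,l}\,\bar g_k^r(\bar g_l^s)^T\in\mathbb{R}^{d_k\times d_l}.$$ The test. Let $\tilde g_N$, $\tilde g_{k;N}^m$, $\tilde g_{k,l;N}^m$ ($k,l=1,\dots,K$, $m=1,\dots,M$) be some estimators (measurable functions of the data $\xi_{1;N},\dots,\xi_{N;N}$) of $\bar g$, $\bar g_k^m$, $\bar g_{k,l}^m$, respectively, where $\tilde g_N=\left((\tilde g_{1;N}^1)^T,\dots,(\tilde g_{K;N}^K)^T\right)^T$. Let $\tilde\Sigma_N:=(\tilde\Sigma_N^{(k,l)})_{k,l=1}^K$ with $$\tilde\Sigma_N^{(k,l)}:=\sum_{m=1}^M\beta_{m;N}^{k,l}\,\tilde g_{k,l;N}^m-\sum_{r,s=1}^M\alpha_{r,s;N}^{k,l}\,\tilde g_{k;N}^r(\tilde g_{l;N}^s)^T,$$ $\hat D_N:=T'(\tilde g_N)\,\tilde\Sigma_N\,(T'(\tilde g_N))^T$, and $\hat s_N:=N\,\hat T_N^T\,\hat D_N^{-1}\,\hat T_N$. The test $\pi_{N,\alpha}$ accepts $H_0$ if $\hat s_N\le Q^{\chi^2_L}(1-\alpha)$ and rejects $H_0$ otherwise, where $Q^{\chi^2_L}(1-\alpha)$ is the quantile of level $1-\alpha$ of the chi-square distribution with $L$ degrees of freedom. (On the event where $T'(\tilde g_N)$ does not exist or $\hat D_N$ is singular,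 the decision of the test may be fixed by an arbitrary convention.) *)

theory Defs
  imports "HOL-Probability.Probability"
begin

text \<open>
  Index conventions. Mixture components are the elements of a finite type \<open>'m\<close> (size \<open>M\<close>), moment
  functions those of a finite type \<open>'k\<close> (size \<open>K\<close>), and the coordinates of
  \<open>\<real>\<^sup>d = \<real>\<^sup>d\<^sub>1 \<times> \<dots> \<times> \<real>\<^sup>d\<^sub>K\<close> those of a finite type \<open>'d\<close>. A map \<open>blk :: 'd \<Rightarrow> 'k\<close> says to which factor a
  coordinate belongs, so that \<open>d\<^sub>k = card (blk -` {k})\<close>. An injection \<open>\<iota> :: 'k \<Rightarrow> 'm\<close> plays the role
  of the inclusion of \<open>{1..K}\<close> into \<open>{1..M}\<close>.

  The functions \<open>g\<^sub>k\<close> are given jointly as one function \<open>g\<close> into \<open>\<real>\<^sup>d\<close>, with \<open>g\<^sub>k\<close> its \<open>k\<close>-th block.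
  Likewise a vector \<open>v\<close> (matrix \<open>A\<close>) over \<open>'d\<close> carries a whole family of vectors \<open>v\<^sub>k\<close> (matrices
  \<open>A\<^sub>k\<^sub>,\<^sub>l\<close>) as its blocks. Observations are numbered \<open>1, \<dots>, N\<close>, and \<open>p N m j\<close> is the concentration
  of component \<open>m\<close> for observation \<open>j\<close>.
\<close>

text \<open>The \<open>k\<close>-th factor of \<open>\<real>\<^sup>d\<close> is identified isometrically with a coordinate subspace.\<close>

definition block_vec :: "('d::finite \<Rightarrow> 'k) \<Rightarrow> 'k \<Rightarrow> real ^ 'd \<Rightarrow> real ^ 'd" where
  "block_vec blk k v = (\<chi> i. if blk i = k then v $ i else 0)"

definition block_mat ::
    "('d::finite \<Rightarrow> 'k) \<Rightarrow> 'k \<Rightarrow> 'k \<Rightarrow> real ^ 'd ^ 'd \<Rightarrow> real ^ 'd ^ 'd" where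
  "block_mat blk k l A = (\<chi> i j. if blk i = k \<and> blk j = l then A $ i $ j else 0)"

text \<open>From \<open>v\<^sub>k\<^sup>m\<close>, the vector with blocks \<open>v\<^sub>k\<^sup>k\<close>.\<close>

definition diag_stack ::
    "('k \<Rightarrow> 'm) \<Rightarrow> ('d::finite \<Rightarrow> 'k) \<Rightarrow> ('m \<Rightarrow> real ^ 'd) \<Rightarrow> real ^ 'd" where
  "diag_stack \<iota> blk v = (\<chi> i. v (\<iota> (blk i)) $ i)"

definition avg :: "nat \<Rightarrow> (nat \<Rightarrow> real) \<Rightarrow> real" where
  "avg N u = (1 / real N) * (\<Sum>j = 1..N. u j)"

definition Gamma_mat :: "(nat \<Rightarrow> 'm::finite \<Rightarrow> nat \<Rightarrow> real) \<Rightarrow> nat \<Rightarrow> real ^ 'm ^ 'm" where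
  "Gamma_mat p N = (\<chi> m i. avg N (\<lambda>j. p N m j * p N i j))"

definition weight :: "(nat \<Rightarrow> 'm::finite \<Rightarrow> nat \<Rightarrow> real) \<Rightarrow> nat \<Rightarrow> 'm \<Rightarrow> nat \<Rightarrow> real" where
  "weight p N m j = (\<Sum>i\<in>UNIV. p N i j * matrix_inv (Gamma_mat p N) $ i $ m)"

definition alpha_coef ::
    "('k \<Rightarrow> 'm) \<Rightarrow> (nat \<Rightarrow> 'm::finite \<Rightarrow> nat \<Rightarrow> real) \<Rightarrow> nat \<Rightarrow> 'm \<Rightarrow> 'm \<Rightarrow> 'k \<Rightarrow> 'k \<Rightarrow> real" where
  "alpha_coef \<iota> p N r s k l =
     avg N (\<lambda>j. weight p N (\<iota> k) j * weight p N (\<iota> l) j * p N r j * p N s j)"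

definition beta_coef ::
    "('k \<Rightarrow> 'm) \<Rightarrow> (nat \<Rightarrow> 'm::finite \<Rightarrow> nat \<Rightarrow> real) \<Rightarrow> nat \<Rightarrow> 'm \<Rightarrow> 'k \<Rightarrow> 'k \<Rightarrow> real" where
  "beta_coef \<iota> p N m k l =
     avg N (\<lambda>j. weight p N (\<iota> k) j * weight p N (\<iota> l) j * p N m j)"

definition moment1 :: "'x measure \<Rightarrow> ('x \<Rightarrow> real ^ 'd::finite) \<Rightarrow> real ^ 'd" where
  "moment1 D g = (\<chi> i. LINT x|D. g x $ i)"

definition moment2 :: "'x measure \<Rightarrow> ('x \<Rightarrow> real ^ 'd::finite) \<Rightarrow> real ^ 'd ^ 'd" where
  "moment2 D g = (\<chi> i j. LINT x|D. g x $ i * g x $ j)"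

text \<open>The common form of \<open>\<Sigma>\<close> and of its estimator, given coefficients \<open>b\<^sub>m\<^sup>k\<^sup>l\<close>, \<open>a\<^sub>r\<^sub>s\<^sup>k\<^sup>l\<close>, second
  moments \<open>G m\<close> and first moments \<open>h m\<close>.\<close>

definition Sigma_mat ::
    "('d::finite \<Rightarrow> 'k) \<Rightarrow> ('m::finite \<Rightarrow> 'k \<Rightarrow> 'k \<Rightarrow> real) \<Rightarrow> ('m \<Rightarrow> 'm \<Rightarrow> 'k \<Rightarrow> 'k \<Rightarrow> real)
     \<Rightarrow> ('m \<Rightarrow> real ^ 'd ^ 'd) \<Rightarrow> ('m \<Rightarrow> real ^ 'd) \<Rightarrow> real ^ 'd ^ 'd" where
  "Sigma_mat blk b a G h = (\<chi> i j.
     (\<Sum>m\<in>UNIV. b m (blk i) (blk j) * G m $ i $ j)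
     - (\<Sum>r\<in>UNIV. \<Sum>s\<in>UNIV. a r s (blk i) (blk j) * (h r $ i * h s $ j)))"

definition D_mat :: "(real ^ 'd \<Rightarrow> real ^ 'l) \<Rightarrow> real ^ 'd::finite \<Rightarrow> real ^ 'd ^ 'd
     \<Rightarrow> real ^ 'l::finite ^ 'l" where
  "D_mat T y S = jacobian T (at y) ** S ** transpose (jacobian T (at y))"

text \<open>Statistics are functions of the data \<open>x = (x\<^sub>1, \<dots>, x\<^sub>N)\<close>.\<close>

definition g_hat :: "('k \<Rightarrow> 'm::finite) \<Rightarrow> ('d::finite \<Rightarrow> 'k) \<Rightarrow> (nat \<Rightarrow> 'm \<Rightarrow> nat \<Rightarrow> real)
     \<Rightarrow> ('x \<Rightarrow> real ^ 'd) \<Rightarrow> nat \<Rightarrow> (nat \<Rightarrow> 'x) \<Rightarrow> real ^ 'd" where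
  "g_hat \<iota> blk p g N x =
     diag_stack \<iota> blk (\<lambda>m. (1 / real N) *\<^sub>R (\<Sum>j = 1..N. weight p N m j *\<^sub>R g (x j)))"

definition D_hat :: "('k \<Rightarrow> 'm::finite) \<Rightarrow> ('d::finite \<Rightarrow> 'k) \<Rightarrow> (nat \<Rightarrow> 'm \<Rightarrow> nat \<Rightarrow> real)
     \<Rightarrow> (real ^ 'd \<Rightarrow> real ^ 'l::finite)
     \<Rightarrow> (nat \<Rightarrow> 'm \<Rightarrow> (nat \<Rightarrow> 'x) \<Rightarrow> real ^ 'd) \<Rightarrow> (nat \<Rightarrow> 'm \<Rightarrow> (nat \<Rightarrow> 'x) \<Rightarrow> real ^ 'd ^ 'd)
     \<Rightarrow> nat \<Rightarrow> (nat \<Rightarrow> 'x) \<Rightarrow> real ^ 'l ^ 'l" where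
  "D_hat \<iota> blk p T e1 e2 N x =
     D_mat T (diag_stack \<iota> blk (\<lambda>m. e1 N m x))
       (Sigma_mat blk (beta_coef \<iota> p N) (alpha_coef \<iota> p N) (\<lambda>m. e2 N m x) (\<lambda>m. e1 N m x))"

definition s_hat :: "('k \<Rightarrow> 'm::finite) \<Rightarrow> ('d::finite \<Rightarrow> 'k) \<Rightarrow> (nat \<Rightarrow> 'm \<Rightarrow> nat \<Rightarrow> real)
     \<Rightarrow> ('x \<Rightarrow> real ^ 'd) \<Rightarrow> (real ^ 'd \<Rightarrow> real ^ 'l::finite)
     \<Rightarrow> (nat \<Rightarrow> 'm \<Rightarrow> (nat \<Rightarrow> 'x) \<Rightarrow> real ^ 'd) \<Rightarrow> (nat \<Rightarrow> 'm \<Rightarrow> (nat \<Rightarrow> 'x) \<Rightarrow> real ^ 'd ^ 'd)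
     \<Rightarrow> nat \<Rightarrow> (nat \<Rightarrow> 'x) \<Rightarrow> real" where
  "s_hat \<iota> blk p g T e1 e2 N x =
     real N * (T (g_hat \<iota> blk p g N x) \<bullet>
       (matrix_inv (D_hat \<iota> blk p T e1 e2 N x) *v T (g_hat \<iota> blk p g N x)))"

definition chi_square :: "nat \<Rightarrow> real measure" where
  "chi_square n = distr (PiM {..<n} (\<lambda>_. std_normal_distribution)) borel (\<lambda>z. \<Sum>i<n. (z i)\<^sup>2)"

definition quantile :: "real measure \<Rightarrow> real \<Rightarrow> real" where
  "quantile D q = Inf {x. q \<le> cdf D x}"

text \<open>
  \<open>R\<close> is the rejection region, a measurable set of data, of the level-\<open>\<alpha>\<close> test for sample size \<open>N\<close>.
  Nothing is prescribed where the derivative of \<open>T\<close> at the estimate does not exist or the estimate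
  of \<open>D\<close> is singular, so the decision there follows an arbitrary (measurable) convention.
\<close>

definition is_rejection_region :: "'x measure \<Rightarrow> ('k \<Rightarrow> 'm::finite) \<Rightarrow> ('d::finite \<Rightarrow> 'k)
     \<Rightarrow> (nat \<Rightarrow> 'm \<Rightarrow> nat \<Rightarrow> real) \<Rightarrow> ('x \<Rightarrow> real ^ 'd) \<Rightarrow> (real ^ 'd \<Rightarrow> real ^ 'l::finite)
     \<Rightarrow> (nat \<Rightarrow> 'm \<Rightarrow> (nat \<Rightarrow> 'x) \<Rightarrow> real ^ 'd) \<Rightarrow> (nat \<Rightarrow> 'm \<Rightarrow> (nat \<Rightarrow> 'x) \<Rightarrow> real ^ 'd ^ 'd)
     \<Rightarrow> nat \<Rightarrow> real \<Rightarrow> (nat \<Rightarrow> 'x) set \<Rightarrow> bool" where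
  "is_rejection_region X \<iota> blk p g T e1 e2 N \<alpha> R \<longleftrightarrow>
     R \<in> sets (PiM {1..N} (\<lambda>_. X)) \<and>
     (\<forall>x \<in> space (PiM {1..N} (\<lambda>_. X)).
        T differentiable (at (diag_stack \<iota> blk (\<lambda>m. e1 N m x))) \<and>
        invertible (D_hat \<iota> blk p T e1 e2 N x) \<longrightarrow>
        (x \<in> R \<longleftrightarrow> \<not> s_hat \<iota> blk p g T e1 e2 N x \<le> quantile (chi_square CARD('l)) (1 - \<alpha>)))"

definition sample :: "(nat \<Rightarrow> nat \<Rightarrow> 'w \<Rightarrow> 'x) \<Rightarrow> nat \<Rightarrow> 'w \<Rightarrow> nat \<Rightarrow> 'x" where
  "sample \<xi> N \<omega> = (\<lambda>j\<in>{1..N}. \<xi> N j \<omega>)"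

definition tendsto_in_prob ::
    "'w measure \<Rightarrow> (nat \<Rightarrow> 'w \<Rightarrow> 'b::metric_space) \<Rightarrow> 'b \<Rightarrow> bool" where
  "tendsto_in_prob P Y c \<longleftrightarrow>
     (\<forall>\<epsilon>>0. (\<lambda>N. measure P {\<omega> \<in> space P. dist (Y N \<omega>) c > \<epsilon>}) \<longlonglongrightarrow> 0)"

end

theory Submission
  imports Defs
begin

text \<open>
  With \<open>D\<^sup>-\<^sup>1 = C C\<^sup>T\<close> and \<open>A = T'(g)\<close> at the true moments \<open>g\<close>, the statistic is, up to an error that vanishes
  in probability, \<open>|Z\<^sub>N|\<^sup>2\<close> for \<open>Z\<^sub>N = C\<^sup>T A (\<surd>N (g\<^sub>N - g))\<close>. The characteristic functions of the projections
  \<open>t \<bullet> Z\<^sub>N\<close> converge to \<open>exp (-|t|\<^sup>2/2)\<close> by Lindeberg's argument: the weights are bounded, so the summands are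
  dominated by a fixed square-integrable function over \<open>\<surd>N\<close>. Instead of a multivariate continuity theorem,
  averaging these characteristic functions over a Gaussian \<open>t\<close> gives convergence of the Laplace transform of
  \<open>|Z\<^sub>N|\<^sup>2\<close>. At the integers these are the moments of \<open>exp (-|Z\<^sub>N|\<^sup>2) \<in> [0,1]\<close>, which by Weierstrass
  approximation determine weak convergence. The Taylor and Slutsky estimates are made deterministically on the event
  that all estimators are close to their limits; the statistic itself need not be measurable there.
\<close>

text \<open>The concentrations differ between observations, so the data form a triangular array of
  independent, not identically distributed terms. Inverting \<open>Gamma_mat\<close> makes the
  weights biorthogonal to the concentrations. Hence, as soon as that matrix is invertible, the
  scaled error of the moment estimator is exactly a row sum of centred independent terms, and its
  covariance is exactly \<Sigma> with finite-sample coefficients. Being a limit of covariances,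
  \<Sigma> is positive semidefinite, and so is \<open>D\<close>; nonsingularity upgrades this to
  positive definiteness, which the factor \<open>C\<close> requires. Integer points of the Laplace
  transform suffice because \<open>exp (- k * x)\<close> is the \<open>k\<close>-th power of
  \<open>exp (- x)\<close>, and this decreasing map sends the half line into a compact interval,
  where polynomials are dense. The rejection event is trapped, outside a small exceptional set,
  between two level sets of the squared norm of \<open>Z\<close>; continuity of the chi-square
  distribution function at the quantile closes the gap.\<close>

section \<open>Mixtures and sums of independent variables\<close>

text \<open>Both sides are additive and homogeneous in \<open>f\<close> and continuous along
  increasing sequences, and \<open>mix\<close> is the case of indicators, so the standard induction
  on nonnegative measurable functions applies.\<close>

lemma nn_integral_mixture:
  fixes c :: "'m \<Rightarrow> real"
  assumes I: "finite I" and sets: "\<And>m. m \<in> I \<Longrightarrow> sets (F m) = sets M"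
    and mix: "\<And>A. A \<in> sets M \<Longrightarrow> emeasure M A = (\<Sum>m\<in>I. ennreal (c m) * emeasure (F m) A)"
    and f: "f \<in> borel_measurable M"
  shows "(\<integral>\<^sup>+x. f x \<partial>M) = (\<Sum>m\<in>I. ennreal (c m) * (\<integral>\<^sup>+x. f x \<partial>F m))"
  using f
proof (induction rule: borel_measurable_induct)
  case (cong f g)
  have "(\<integral>\<^sup>+x. f x \<partial>M) = (\<integral>\<^sup>+x. g x \<partial>M)"
    by (rule nn_integral_cong) (use cong in auto)
  moreover have "(\<integral>\<^sup>+x. f x \<partial>F m) = (\<integral>\<^sup>+x. g x \<partial>F m)" if "m \<in> I" for m
    by (rule nn_integral_cong) (use cong sets_eq_imp_space_eq[OF sets[OF that]] in auto)
  ultimately show ?case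
    using cong by simp
next
  case (set A)
  then show ?case
    using sets by (simp add: mix)
next
  case (mult u c')
  have "(\<integral>\<^sup>+x. c' * u x \<partial>F m) = c' * (\<integral>\<^sup>+x. u x \<partial>F m)" if "m \<in> I" for m
    by (rule nn_integral_cmult) (use mult measurable_cong_sets[OF sets[OF that] refl] in auto)
  then show ?case
    using mult by (simp add: nn_integral_cmult sum_distrib_left ac_simps)
next
  case (add u v)
  have "(\<integral>\<^sup>+x. v x + u x \<partial>F m) = (\<integral>\<^sup>+x. v x \<partial>F m) + (\<integral>\<^sup>+x. u x \<partial>F m)" if "m \<in> I" for m
  proof (rule nn_integral_add)
    show "v \<in> borel_measurable (F m)" "u \<in> borel_measurable (F m)"
      unfolding measurable_cong_sets[OF sets[OF that] refl] by (simp_all add: add)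
  qed
  then show ?case
    using add by (simp add: nn_integral_add sum.distrib distrib_left)
next
  case (seq U)
  \<comment> \<open>Monotone convergence is phrased with limits instead of suprema, so that it
    passes through the finite sum over components; uniqueness of limits then ends the case.\<close>
  have lim: "(\<lambda>i. \<integral>\<^sup>+x. U i x \<partial>N) \<longlonglongrightarrow> (\<integral>\<^sup>+x. (SUP i. U i x) \<partial>N)"
    if "\<And>i. U i \<in> borel_measurable N" for N
  proof -
    have "incseq (\<lambda>i. \<integral>\<^sup>+x. U i x \<partial>N)"
      using seq(3) by (auto simp: incseq_def le_fun_def intro!: nn_integral_mono)
    then show ?thesis
      using LIMSEQ_SUP nn_integral_monotone_convergence_SUP[OF seq(3) that] by simp
  qed
  have "(\<lambda>i. \<Sum>m\<in>I. ennreal (c m) * (\<integral>\<^sup>+x. U i x \<partial>F m)) \<longlonglongrightarrow> (\<Sum>m\<in>I. ennreal (c m) * (\<integral>\<^sup>+x. (SUP i. U i x) \<partial>F m))"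
    by (intro tendsto_sum ennreal_tendsto_cmult lim)
      (use seq(1) measurable_cong_sets[OF sets refl] in auto)
  moreover have "(\<lambda>i. \<Sum>m\<in>I. ennreal (c m) * (\<integral>\<^sup>+x. U i x \<partial>F m)) \<longlonglongrightarrow> (\<integral>\<^sup>+x. (SUP i. U i x) \<partial>M)"
    using lim[OF seq(1)] seq by simp
  ultimately show ?case
    using LIMSEQ_unique by (auto simp: image_comp)
qed

lemma integral_mixture:
  fixes f :: "'x \<Rightarrow> real" and c :: "'m \<Rightarrow> real"
  assumes I: "finite I" and sets: "\<And>m. m \<in> I \<Longrightarrow> sets (F m) = sets M"
    and c: "\<And>m. m \<in> I \<Longrightarrow> c m \<ge> 0"
    and mix: "\<And>A. A \<in> sets M \<Longrightarrow> emeasure M A = (\<Sum>m\<in>I. ennreal (c m) * emeasure (F m) A)"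
    and f: "f \<in> borel_measurable M" "\<And>m. m \<in> I \<Longrightarrow> integrable (F m) f"
  shows "integrable M f" "(LINT x|M. f x) = (\<Sum>m\<in>I. c m * (LINT x|F m. f x))"
proof -
  have fin: "(\<integral>\<^sup>+x. ennreal (norm (f x)) \<partial>F m) < \<infinity>" if "m \<in> I" for m
    using f(2)[OF that] by (simp add: integrable_iff_bounded)
  have eq: "(\<integral>\<^sup>+x. h x \<partial>M) = (\<Sum>m\<in>I. ennreal (c m) * (\<integral>\<^sup>+x. h x \<partial>F m))"
    if "h \<in> borel_measurable M" for h
    by (rule nn_integral_mixture[OF I sets mix that])
  show int: "integrable M f"
    unfolding integrable_iff_bounded using f(1) fin I
    by (simp add: eq less_top[symmetric] ennreal_mult_eq_top_iff)
  \<comment> \<open>Used for \<open>f\<close> and for \<open>- f\<close>, the two parts in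
    \<open>real_lebesgue_integral_def\<close>. Domination by \<open>norm (f x)\<close> keeps both
    finite, so that \<open>enn2real\<close> loses nothing.\<close>
  have pos: "(\<integral>\<^sup>+x. ennreal (f' x) \<partial>M) = ennreal (\<Sum>m\<in>I. c m * enn2real (\<integral>\<^sup>+x. ennreal (f' x) \<partial>F m))"
    if f': "f' \<in> borel_measurable M" "\<And>x. f' x \<le> norm (f x)" for f'
  proof -
    have "(\<integral>\<^sup>+x. ennreal (f' x) \<partial>F m) \<le> (\<integral>\<^sup>+x. ennreal (norm (f x)) \<partial>F m)" for m
      using f' by (intro nn_integral_mono ennreal_leI) auto
    then have "(\<integral>\<^sup>+x. ennreal (f' x) \<partial>F m) = ennreal (enn2real (\<integral>\<^sup>+x. ennreal (f' x) \<partial>F m))" if "m \<in> I" for m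
      using fin[OF that] by (metis ennreal_enn2real infinity_ennreal_def le_less_trans)
    then have "(\<integral>\<^sup>+x. ennreal (f' x) \<partial>M)
      = (\<Sum>m\<in>I. ennreal (c m) * ennreal (enn2real (\<integral>\<^sup>+x. ennreal (f' x) \<partial>F m)))"
      using f' by (subst eq) (auto intro!: sum.cong)
    also have "\<dots> = (\<Sum>m\<in>I. ennreal (c m * enn2real (\<integral>\<^sup>+x. ennreal (f' x) \<partial>F m)))"
      by (intro sum.cong refl ennreal_mult[symmetric]) (auto simp: c)
    finally show ?thesis
      by (simp add: sum_ennreal c)
  qed
  show "(LINT x|M. f x) = (\<Sum>m\<in>I. c m * (LINT x|F m. f x))"
    using f by (simp add: real_lebesgue_integral_def int pos sum_nonneg c right_diff_distrib sum_subtractf)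
qed

text \<open>The upper bound comes from \<open>(1 - u + u^2/2) * (1 + u + u^2/2) = 1 + u^4/4\<close>
  together with the quadratic Taylor lower bound for \<open>exp u\<close>.\<close>

lemma abs_exp_minus_linear_le:
  fixes u :: real
  assumes "0 \<le> u"
  shows "\<bar>exp (- u) - (1 - u)\<bar> \<le> u\<^sup>2 / 2"
proof -
  have "1 \<le> (1 - u + u\<^sup>2 / 2) * (1 + u + u\<^sup>2 / 2)"
    using zero_le_power2[of "u\<^sup>2"] by (simp add: algebra_simps power2_eq_square)
  also have "\<dots> \<le> (1 - u + u\<^sup>2 / 2) * exp u"
    using exp_lower_Taylor_quadratic[OF assms] sum_squares_ge_zero[of "1 - u" 1]
    by (intro mult_left_mono) (auto simp: power2_eq_square algebra_simps)
  finally have "exp (- u) \<le> 1 - u + u\<^sup>2 / 2"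
    by (simp add: exp_minus field_simps)
  moreover have "1 - u \<le> exp (- u)"
    using exp_ge_add_one_self[of "- u"] by simp
  ultimately show ?thesis
    by auto
qed

text \<open>For factors of modulus at most 1, a difference of products is at most the sum of the
  differences of the factors. The characteristic function of \<open>X j\<close> and
  \<open>exp (- v j / 2)\<close> are both close to \<open>1 - v j / 2\<close>: the former by a
  Taylor bound with Lindeberg-type remainder, the latter up to the square of \<open>v j\<close>.
  Evaluation at 1 is no restriction, since a scalar can be absorbed into \<open>X\<close>.\<close>

lemma (in prob_space) char_indep_sum_approx:
  fixes X :: "'i \<Rightarrow> 'a \<Rightarrow> real"
  assumes J: "finite J" and indep: "indep_vars (\<lambda>_. borel) X J"
    and sq: "\<And>j. j \<in> J \<Longrightarrow> integrable M (\<lambda>\<omega>. (X j \<omega>)\<^sup>2)"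
    and mean: "\<And>j. j \<in> J \<Longrightarrow> expectation (X j) = 0"
  shows "cmod (char (distr M borel (\<lambda>\<omega>. \<Sum>j\<in>J. X j \<omega>)) 1
      - exp (- (\<Sum>j\<in>J. expectation (\<lambda>\<omega>. (X j \<omega>)\<^sup>2)) / 2))
    \<le> (\<Sum>j\<in>J. expectation (\<lambda>\<omega>. min (6 * (X j \<omega>)\<^sup>2) (\<bar>X j \<omega>\<bar> ^ 3)))
      + (\<Sum>j\<in>J. (expectation (\<lambda>\<omega>. (X j \<omega>)\<^sup>2))\<^sup>2)"
proof -
  define v where "v j = expectation (\<lambda>\<omega>. (X j \<omega>)\<^sup>2)" for j
  define r where "r j = expectation (\<lambda>\<omega>. min (6 * (X j \<omega>)\<^sup>2) (\<bar>X j \<omega>\<bar> ^ 3))" for j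
  define \<phi> where "\<phi> j = char (distr M borel (X j)) 1" for j
  have rv[measurable]: "random_variable borel (X j)" if "j \<in> J" for j
    using indep that by (simp add: indep_vars_def2)
  have v0: "0 \<le> v j" for j
    by (simp add: v_def)
  have r0: "0 \<le> r j" for j
    by (simp add: r_def)
  have \<phi>: "cmod (\<phi> j - (1 - v j / 2)) \<le> r j / 6" if j: "j \<in> J" for j
  proof -
    have int: "integrable M (X j)"
      by (rule square_integrable_imp_integrable[OF rv[OF j] sq[OF j]])
    have "variance (X j) = v j"
      by (simp add: mean[OF j] v_def)
    from char_approx3'[OF rv[OF j] int sq[OF j] mean[OF j] this refl, of 1]
    show ?thesis
      by (simp add: \<phi>_def r_def)
  qed
  have \<phi>1: "cmod (\<phi> j) \<le> 1" if j: "j \<in> J" for j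
    unfolding \<phi>_def by (rule real_distribution.cmod_char_le_1[OF real_distribution_distr[OF rv[OF j]]])
  have diff: "cmod (\<phi> j - exp (- v j / 2)) \<le> r j + (v j)\<^sup>2" if j: "j \<in> J" for j
  proof -
    have "\<phi> j - of_real (exp (- v j / 2)) = (\<phi> j - (1 - v j / 2)) - of_real (exp (- (v j / 2)) - (1 - v j / 2))"
      by simp
    also have "cmod \<dots> \<le> r j / 6 + (v j / 2)\<^sup>2 / 2"
      using abs_exp_minus_linear_le[of "v j / 2"] v0
      by (intro order_trans[OF norm_triangle_ineq4] add_mono \<phi>[OF j]) (simp only: norm_of_real, simp)
    \<comment> \<open>The constants 1/6 and 1/8 are rounded up to 1; only the rate matters
      later.\<close>
    also have "\<dots> \<le> r j + (v j)\<^sup>2"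
      using r0[of j] v0[of j] by (intro add_mono) (auto simp: power2_eq_square field_simps)
    finally show ?thesis .
  qed
  have "char (distr M borel (\<lambda>\<omega>. \<Sum>j\<in>J. X j \<omega>)) 1 = (\<Prod>j\<in>J. \<phi> j)"
    unfolding \<phi>_def by (rule char_distr_sum[OF indep])
  moreover have "exp (- (\<Sum>j\<in>J. v j) / 2) = (\<Prod>j\<in>J. exp (- v j / 2))"
    by (simp add: exp_sum[OF J, symmetric] sum_negf sum_divide_distrib)
  ultimately have "cmod (char (distr M borel (\<lambda>\<omega>. \<Sum>j\<in>J. X j \<omega>)) 1 - exp (- (\<Sum>j\<in>J. v j) / 2))
      = cmod ((\<Prod>j\<in>J. \<phi> j) - (\<Prod>j\<in>J. of_real (exp (- v j / 2))))"
    by simp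
  also have "\<dots> \<le> (\<Sum>j\<in>J. cmod (\<phi> j - of_real (exp (- v j / 2))))"
    by (rule norm_prod_diff) (use \<phi>1 v0 in auto)
  also have "\<dots> \<le> (\<Sum>j\<in>J. r j + (v j)\<^sup>2)"
    by (intro sum_mono) (use diff in auto)
  finally show ?thesis
    by (simp add: v_def r_def sum.distrib)
qed

lemma (in prob_space) second_moment_indep_sum:
  fixes X :: "'i \<Rightarrow> 'a \<Rightarrow> real"
  assumes J: "finite J" and indep: "indep_vars (\<lambda>_. borel) X J"
    and sq: "\<And>j. j \<in> J \<Longrightarrow> integrable M (\<lambda>\<omega>. (X j \<omega>)\<^sup>2)"
    and mean: "\<And>j. j \<in> J \<Longrightarrow> expectation (X j) = 0"
  shows "integrable M (\<lambda>\<omega>. (\<Sum>j\<in>J. X j \<omega>)\<^sup>2)"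
    "expectation (\<lambda>\<omega>. (\<Sum>j\<in>J. X j \<omega>)\<^sup>2) = (\<Sum>j\<in>J. expectation (\<lambda>\<omega>. (X j \<omega>)\<^sup>2))"
proof -
  have rv: "random_variable borel (X j)" if "j \<in> J" for j
    using indep that by (simp add: indep_vars_def2)
  have int: "integrable M (X j)" if "j \<in> J" for j
    by (rule square_integrable_imp_integrable[OF rv sq]) (use that in auto)
  have prod: "integrable M (\<lambda>\<omega>. X i \<omega> * X j \<omega>)
      \<and> expectation (\<lambda>\<omega>. X i \<omega> * X j \<omega>) = (if i = j then expectation (\<lambda>\<omega>. (X i \<omega>)\<^sup>2) else 0)"
    if ij: "i \<in> J" "j \<in> J" for i j
  proof (cases "i = j")
    case True
    then show ?thesis
      using sq[OF ij(1)] by (simp add: power2_eq_square)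
  next
    case False
    have indep': "indep_vars (\<lambda>_. borel) X {i, j}"
      by (rule indep_vars_subset[OF indep]) (use ij in auto)
    have int': "\<And>k. k \<in> {i, j} \<Longrightarrow> integrable M (X k)"
      using int ij by auto
    show ?thesis
      using False indep_vars_integrable[OF _ indep' int'] indep_vars_lebesgue_integral[OF _ indep' int']
        mean[OF ij(1)] by simp
  qed
  have sum_sq: "(\<Sum>j\<in>J. X j \<omega>)\<^sup>2 = (\<Sum>i\<in>J. \<Sum>j\<in>J. X i \<omega> * X j \<omega>)" for \<omega>
    by (simp add: power2_eq_square sum_product)
  note prod_int = prod[THEN conjunct1] and prod_eq = prod[THEN conjunct2]
  show "integrable M (\<lambda>\<omega>. (\<Sum>j\<in>J. X j \<omega>)\<^sup>2)"
    unfolding sum_sq by (intro Bochner_Integration.integrable_sum prod_int)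
  have "expectation (\<lambda>\<omega>. (\<Sum>j\<in>J. X j \<omega>)\<^sup>2) = (\<Sum>i\<in>J. expectation (\<lambda>\<omega>. \<Sum>j\<in>J. X i \<omega> * X j \<omega>))"
    unfolding sum_sq by (intro Bochner_Integration.integral_sum Bochner_Integration.integrable_sum prod_int)
  also have "\<dots> = (\<Sum>i\<in>J. \<Sum>j\<in>J. expectation (\<lambda>\<omega>. X i \<omega> * X j \<omega>))"
    by (intro sum.cong refl Bochner_Integration.integral_sum prod_int)
  also have "\<dots> = (\<Sum>i\<in>J. \<Sum>j\<in>J. if i = j then expectation (\<lambda>\<omega>. (X i \<omega>)\<^sup>2) else 0)"
    by (intro sum.cong refl prod_eq)
  finally show "expectation (\<lambda>\<omega>. (\<Sum>j\<in>J. X j \<omega>)\<^sup>2) = (\<Sum>j\<in>J. expectation (\<lambda>\<omega>. (X j \<omega>)\<^sup>2))"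
    using J by (simp add: sum.delta')
qed

section \<open>Weak convergence to the chi-square law\<close>

text \<open>Weak convergence needs testing only on the functions \<open>cts_step x y\<close>. One
  polynomial approximates such a function uniformly on the unit interval, hence simultaneously for
  all \<open>\<mu> n\<close> and for \<open>\<nu>\<close>, and its integrals are finite combinations
  of moments; this gives three errors of size \<open>r / 3\<close>.\<close>

lemma weak_conv_m_of_moments:
  fixes \<mu> :: "nat \<Rightarrow> real measure" and \<nu> :: "real measure"
  assumes dist: "\<And>n. real_distribution (\<mu> n)" "real_distribution \<nu>"
    and unit: "\<And>n. AE x in \<mu> n. x \<in> {0..1}" "AE x in \<nu>. x \<in> {0..1}"
    and moments: "\<And>k. (\<lambda>n. LINT x|\<mu> n. x ^ k) \<longlonglongrightarrow> (LINT x|\<nu>. x ^ k)"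
  shows "weak_conv_m \<mu> \<nu>"
proof (rule integral_cts_step_conv_imp_weak_conv[OF dist])
  fix x y :: real
  assume xy: "x < y"
  let ?f = "cts_step x y"
  have int_pow: "integrable D (\<lambda>x. x ^ k)"
    if D: "real_distribution D" "AE x in D. x \<in> {0..1}" for D k
  proof -
    interpret real_distribution D by (rule D)
    show ?thesis
      by (rule integrable_const_bound[of _ 1], rule eventually_mono[OF D(2)]) (auto simp: power_le_one)
  qed
  show "(\<lambda>n. integral\<^sup>L (\<mu> n) ?f) \<longlonglongrightarrow> integral\<^sup>L \<nu> ?f"
  proof (rule LIMSEQ_I)
    fix r :: real
    assume "0 < r"
    then have r: "0 < r / 3" by simp
    have "continuous_on {0..1} ?f"
      by (rule continuous_on_subset[OF uniformly_continuous_imp_continuous[OF cts_step_uniformly_continuous[OF xy]]]) simp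
    then obtain g :: "real \<Rightarrow> real" where "real_polynomial_function g" and g: "\<And>x. x \<in> {0..1} \<Longrightarrow> \<bar>?f x - g x\<bar> < r / 3"
      using Stone_Weierstrass_real_polynomial_function[OF compact_Icc _ r] by blast
    then obtain a n where gdef: "g = (\<lambda>x. \<Sum>i\<le>n. a i * x ^ i)"
      using real_polynomial_function_iff_sum by blast
    have close: "\<bar>integral\<^sup>L D ?f - (\<Sum>i\<le>n. a i * (LINT x|D. x ^ i))\<bar> \<le> r / 3"
      if D: "real_distribution D" "AE x in D. x \<in> {0..1}" for D
    proof -
      interpret real_distribution D by (rule D)
      have gi: "integrable D g"
        unfolding gdef by (intro Bochner_Integration.integrable_sum integrable_mult_right int_pow D)
      have "(\<Sum>i\<le>n. a i * (LINT x|D. x ^ i)) = integral\<^sup>L D g"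
        unfolding gdef by (subst Bochner_Integration.integral_sum) (auto intro!: integrable_mult_right int_pow D)
      then have "\<bar>integral\<^sup>L D ?f - (\<Sum>i\<le>n. a i * (LINT x|D. x ^ i))\<bar> = \<bar>LINT x|D. ?f x - g x\<bar>"
        by (simp add: integrable_cts_step[OF xy] gi)
      also have "\<dots> \<le> (LINT x|D. \<bar>?f x - g x\<bar>)"
        by (rule integral_abs_bound)
      also have "\<dots> \<le> (LINT x|D. r / 3)"
        by (intro integral_mono_AE integrable_abs Bochner_Integration.integrable_diff integrable_cts_step xy gi
            integrable_const eventually_mono[OF D(2)] less_imp_le[OF g])
      also have "\<dots> = r / 3"
        using prob_space by simp
      finally show ?thesis .
    qed
    have "(\<lambda>k. \<Sum>i\<le>n. a i * (LINT x|\<mu> k. x ^ i)) \<longlonglongrightarrow> (\<Sum>i\<le>n. a i * (LINT x|\<nu>. x ^ i))"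
      by (intro tendsto_intros moments)
    from LIMSEQ_D[OF this r] obtain N where N: "\<And>k. k \<ge> N \<Longrightarrow>
        norm ((\<Sum>i\<le>n. a i * (LINT x|\<mu> k. x ^ i)) - (\<Sum>i\<le>n. a i * (LINT x|\<nu>. x ^ i))) < r / 3"
      by blast
    have "norm (integral\<^sup>L (\<mu> k) ?f - integral\<^sup>L \<nu> ?f) < r" if "k \<ge> N" for k
      using N[OF that] close[OF dist(1) unit(1), of k] close[OF dist(2) unit(2)]
      unfolding real_norm_def by linarith
    then show "\<exists>N. \<forall>k\<ge>N. norm (integral\<^sup>L (\<mu> k) ?f - integral\<^sup>L \<nu> ?f) < r"
      by blast
  qed
qed

section \<open>Chi-square distributions: absence of atoms, quantiles\<close>

lemma product_prob_space_std_normal: "product_prob_space (\<lambda>_. std_normal_distribution)"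
  by (rule product_prob_spaceI) (rule real_dist_normal_dist[THEN real_distribution.axioms(1)])

lemma real_distribution_chi_square: "real_distribution (chi_square n)"
proof -
  interpret product_prob_space "\<lambda>_::nat. std_normal_distribution" "{..<n}"
    by (rule product_prob_space_std_normal)
  show ?thesis
    unfolding chi_square_def
    by (intro prob_space.real_distribution_distr prob_space_axioms) measurable
qed

lemma std_normal_null_finite:
  assumes "finite A"
  shows "emeasure std_normal_distribution A = 0"
proof -
  have "A \<in> null_sets lborel"
    using assms by (rule finite_imp_null_set_lborel)
  then have "A \<in> null_sets std_normal_distribution"
    using absolutely_continuousI_density[of std_normal_density lborel] unfolding absolutely_continuous_def by auto
  then show ?thesis by auto
qed

text \<open>Fubini in the last coordinate: with the others fixed, its square is prescribed, which
  leaves at most two values and hence a null set. Positivity of \<open>n\<close> provides that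
  coordinate; with no summands the law is a point mass.\<close>

lemma chi_square_singleton:
  assumes "0 < n"
  shows "measure (chi_square n) {c} = 0"
proof -
  from assms obtain k where n: "n = Suc k"
    using gr0_implies_Suc by blast
  interpret product_prob_space "\<lambda>_::nat. std_normal_distribution" "{..<n}"
    by (rule product_prob_space_std_normal)
  let ?S = "\<lambda>z. \<Sum>i<n. (z i :: real)\<^sup>2"
  have "emeasure (chi_square n) {c} = (\<integral>\<^sup>+z. indicator {c} (?S z) \<partial>PiM {..<n} (\<lambda>_. std_normal_distribution))"
    unfolding chi_square_def
    by (subst nn_integral_indicator[symmetric], simp, subst nn_integral_distr) auto
  also have "\<dots> = (\<integral>\<^sup>+z. (\<integral>\<^sup>+y. indicator {c} (?S (z(k := y))) \<partial>std_normal_distribution)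
      \<partial>PiM {..<k} (\<lambda>_. std_normal_distribution))"
    unfolding n lessThan_Suc by (rule product_nn_integral_insert) auto
  also have "(\<lambda>z. \<integral>\<^sup>+y. indicator {c} (?S (z(k := y))) \<partial>std_normal_distribution) = (\<lambda>z. 0)"
  proof
    fix z :: "nat \<Rightarrow> real"
    let ?A = "{y. ?S (z(k := y)) = c}"
    have "?S (z(k := y)) = (\<Sum>i<k. (z i)\<^sup>2) + y\<^sup>2" for y
      unfolding n by simp
    \<comment> \<open>If the radicand is negative, \<open>sqrt\<close> returns a negative real with
      no meaning here, but then \<open>?A\<close> is empty and the inclusion still holds.\<close>
    then have "?A \<subseteq> {sqrt (c - (\<Sum>i<k. (z i)\<^sup>2)), - sqrt (c - (\<Sum>i<k. (z i)\<^sup>2))}"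
      by (auto simp: real_sqrt_unique)
    then have "finite ?A"
      by (rule finite_subset) simp
    moreover have "indicator {c} (?S (z(k := y))) = (indicator ?A y :: ennreal)" for y
      by (simp add: indicator_def)
    ultimately show "(\<integral>\<^sup>+y. indicator {c} (?S (z(k := y))) \<partial>std_normal_distribution) = 0"
      using finite_imp_closed[of ?A] by (simp add: std_normal_null_finite)
  qed
  finally show ?thesis
    by (simp add: measure_def)
qed

text \<open>Without atoms the distribution function is continuous. The superlevel set is then closed
  and contains its infimum, which gives one inequality; the other follows by monotonicity from a
  point with value exactly \<open>q\<close>, supplied by the intermediate value theorem. The bounds
  on \<open>q\<close> make the set nonempty and bounded below, so that \<open>Inf\<close> has its
  intended value.\<close>

lemma (in real_distribution) cdf_quantile:
  assumes atomless: "\<And>x. measure M {x} = 0" and q: "0 < q" "q < 1"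
  shows "cdf M (quantile M q) = q"
proof -
  let ?S = "{x. q \<le> cdf M x}"
  have cont: "continuous_on UNIV (cdf M)"
    using isCont_cdf atomless by (simp add: continuous_on_eq_continuous_at)
  obtain u where u: "q < cdf M u"
    using order_tendstoD(1)[OF cdf_lim_at_top_prob q(2)] unfolding eventually_at_top_linorder by blast
  obtain l where l: "\<And>x. x \<le> l \<Longrightarrow> cdf M x < q"
    using order_tendstoD(2)[OF cdf_lim_at_bot q(1)] unfolding eventually_at_bot_linorder by blast
  have "l \<le> u"
    using u l[of u] by force
  then obtain x where x: "cdf M x = q"
    using IVT'[of "cdf M" l q u] l[of l] u continuous_on_subset[OF cont] by force
  have bdd: "bdd_below ?S"
    using l by (intro bdd_belowI[of _ l]) (metis linorder_le_cases mem_Collect_eq not_le)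
  have "closed ?S"
    by (intro closed_Collect_le cont continuous_intros)
  then have "Inf ?S \<in> ?S"
    using x bdd by (intro closed_contains_Inf) auto
  moreover have "cdf M (Inf ?S) \<le> cdf M x"
    using x bdd by (intro cdf_nondecreasing cInf_lower) auto
  ultimately show ?thesis
    using x by (simp add: quantile_def)
qed

section \<open>Laplace transforms as Gaussian averages of characteristic functions\<close>

lemma char_distr_one:
  assumes "f \<in> borel_measurable M"
  shows "char (distr M borel f) 1 = (CLINT x|M. iexp (f x))"
  using assms by (simp add: char_def integral_distr)

text \<open>Unlike the product in \<open>chi_square\<close>, this one is indexed by the coordinate
  type of the vectors, so that a point \<open>\<zeta>\<close> can be read as the vector
  \<open>\<chi> l. \<zeta> l\<close>.\<close>

definition std_gauss :: "('i::finite \<Rightarrow> real) measure" where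
  "std_gauss = PiM UNIV (\<lambda>_. std_normal_distribution)"

lemma prob_space_std_gauss: "prob_space std_gauss"
  unfolding std_gauss_def by (intro prob_space_PiM real_dist_normal_dist[THEN real_distribution.axioms(1)])

lemma chi_square_eq_distr_std_gauss:
  "chi_square CARD('l) = distr (std_gauss :: ('l::finite \<Rightarrow> real) measure) borel (\<lambda>z. \<Sum>l\<in>UNIV. (z l)\<^sup>2)"
proof -
  obtain h :: "nat \<Rightarrow> 'l" where h: "bij_betw h {..<CARD('l)} UNIV"
    using ex_bij_betw_nat_finite[of "UNIV :: 'l set"] by (auto simp: atLeast0LessThan)
  let ?n = "CARD('l)"
  have "PiM {..<?n} (\<lambda>_. std_normal_distribution)
    = distr std_gauss (PiM {..<?n} (\<lambda>_. std_normal_distribution)) (\<lambda>\<omega>. \<lambda>n\<in>{..<?n}. \<omega> (h n))"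
    unfolding std_gauss_def
    by (rule distr_PiM_reindex[symmetric])
      (use h real_dist_normal_dist[THEN real_distribution.axioms(1)] in \<open>auto simp: bij_betw_def\<close>)
  then have "chi_square ?n
    = distr (distr std_gauss (PiM {..<?n} (\<lambda>_. std_normal_distribution)) (\<lambda>\<omega>. \<lambda>n\<in>{..<?n}. \<omega> (h n))) borel
        (\<lambda>z. \<Sum>i<?n. (z i)\<^sup>2)"
    by (simp add: chi_square_def)
  also have "\<dots> = distr std_gauss borel ((\<lambda>z. \<Sum>i<?n. (z i)\<^sup>2) \<circ> (\<lambda>\<omega>. \<lambda>n\<in>{..<?n}. \<omega> (h n)))"
    by (rule distr_distr) (auto simp: std_gauss_def)
  also have "(\<lambda>z. \<Sum>i<?n. (z i)\<^sup>2) \<circ> (\<lambda>\<omega>. \<lambda>n\<in>{..<?n}. \<omega> (h n)) = (\<lambda>z. \<Sum>l\<in>UNIV. (z l :: real)\<^sup>2)"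
    using sum.reindex_bij_betw[OF h, of "\<lambda>l. (_ l)\<^sup>2"] by (auto simp: fun_eq_iff)
  finally show ?thesis .
qed

text \<open>The Gaussian density is its own Fourier transform up to scaling, so \<open>exp (- s |z|\<^sup>2)\<close> is an average of
  characters of \<open>z\<close>.\<close>

lemma exp_norm_sq_eq_gaussian_average:
  fixes z :: "real ^ 'l::finite"
  assumes s: "0 \<le> s"
  shows "complex_of_real (exp (- s * (norm z)\<^sup>2))
    = (CLINT \<zeta>|std_gauss. iexp ((sqrt (2 * s) *\<^sub>R (\<chi> l. \<zeta> l)) \<bullet> z))"
proof -
  interpret product_prob_space "\<lambda>_::'l. std_normal_distribution" UNIV
    by (rule product_prob_space_std_normal)
  have "iexp ((sqrt (2 * s) *\<^sub>R (\<chi> l. \<zeta> l)) \<bullet> z) = (\<Prod>l\<in>UNIV. iexp (sqrt (2 * s) * z $ l * \<zeta> l))" for \<zeta>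
    by (simp add: inner_vec_def exp_sum[symmetric] sum_distrib_left ac_simps)
  then have "(CLINT \<zeta>|std_gauss. iexp ((sqrt (2 * s) *\<^sub>R (\<chi> l. \<zeta> l)) \<bullet> z))
    = (CLINT \<zeta>|PiM UNIV (\<lambda>_. std_normal_distribution). \<Prod>l\<in>UNIV. iexp (sqrt (2 * s) * z $ l * \<zeta> l))"
    by (simp add: std_gauss_def)
  also have "\<dots> = (\<Prod>l\<in>UNIV. CLINT x|std_normal_distribution. iexp (sqrt (2 * s) * z $ l * x))"
    by (intro product_integral_prod prob_space.integrable_iexp[OF real_dist_normal_dist[THEN real_distribution.axioms(1)]]) auto
  also have "\<dots> = (\<Prod>l\<in>UNIV. char std_normal_distribution (sqrt (2 * s) * z $ l))"
    by (simp add: char_def)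
  \<comment> \<open>The characteristic function of a standard normal at \<open>u\<close> is
    \<open>exp (- u^2 / 2)\<close>; the factor \<open>sqrt (2 * s)\<close> is chosen to cancel the
    1/2 and produce \<open>s\<close>.\<close>
  also have "\<dots> = (\<Prod>l\<in>UNIV. complex_of_real (exp (- s * (z $ l)\<^sup>2)))"
    using s by (simp add: char_std_normal_distribution power_mult_distrib)
  also have "\<dots> = complex_of_real (exp (- s * (norm z)\<^sup>2))"
    by (simp add: exp_sum[symmetric] norm_vec_def L2_set_def sum_nonneg sum_distrib_left sum_negf
        flip: of_real_prod)
  finally show ?thesis by simp
qed

context prob_space
begin

text \<open>The Gaussian average sits inside the expectation. Fubini, legitimate because the
  integrand has modulus 1 on a product of probability spaces, moves it outside and leaves
  characteristic functions of linear projections.\<close>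

lemma laplace_norm_sq:
  fixes Z :: "'a \<Rightarrow> real ^ 'l::finite"
  assumes Z[measurable]: "Z \<in> borel_measurable M" and s: "0 \<le> s"
  shows "complex_of_real (expectation (\<lambda>\<omega>. exp (- s * (norm (Z \<omega>))\<^sup>2)))
    = (CLINT \<zeta>|std_gauss. char (distr M borel (\<lambda>\<omega>. (sqrt (2 * s) *\<^sub>R (\<chi> l. \<zeta> l)) \<bullet> Z \<omega>)) 1)"
proof -
  interpret G: prob_space "std_gauss :: ('l \<Rightarrow> real) measure"
    by (rule prob_space_std_gauss)
  interpret pair_prob_space M "std_gauss :: ('l \<Rightarrow> real) measure" ..
  have Zl: "(\<lambda>\<omega>. Z \<omega> $ l) \<in> borel_measurable M" for l
    by (rule measurable_compose[OF Z borel_measurable_nth])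
  have comp: "(\<lambda>\<zeta>. \<zeta> l) \<in> borel_measurable (std_gauss :: ('l \<Rightarrow> real) measure)" for l
    unfolding std_gauss_def by measurable
  let ?f = "\<lambda>\<omega> \<zeta>. (sqrt (2 * s) *\<^sub>R (\<chi> l. \<zeta> l)) \<bullet> Z \<omega>"
  define f where "f x = ?f (fst x) (snd x)" for x
  \<comment> \<open>Points of \<open>std_gauss\<close> are functions with the product
    \<sigma>-algebra, not vectors, so joint measurability goes through coordinates.\<close>
  have f[measurable]: "f \<in> borel_measurable (M \<Otimes>\<^sub>M std_gauss)"
    unfolding f_def inner_vec_def vector_scaleR_component vec_lambda_beta inner_real_def real_scaleR_def
    by (intro borel_measurable_sum borel_measurable_times borel_measurable_const
        measurable_compose[OF measurable_snd comp] measurable_compose[OF measurable_fst Zl])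
  have "integrable (M \<Otimes>\<^sub>M std_gauss) (\<lambda>x. iexp (f x))"
    by (rule P.integrable_iexp) auto
  then have int: "integrable (M \<Otimes>\<^sub>M std_gauss) (\<lambda>(\<omega>, \<zeta>). iexp (?f \<omega> \<zeta>))"
    unfolding f_def case_prod_beta .
  have "complex_of_real (LINT \<omega>|M. exp (- s * (norm (Z \<omega>))\<^sup>2))
      = (CLINT \<omega>|M. CLINT \<zeta>|std_gauss. iexp (?f \<omega> \<zeta>))"
    unfolding integral_complex_of_real[symmetric] exp_norm_sq_eq_gaussian_average[OF s] ..
  also have "\<dots> = (CLINT \<zeta>|std_gauss. CLINT \<omega>|M. iexp (?f \<omega> \<zeta>))"
    by (rule Fubini_integral[symmetric, OF int])
  also have "\<dots> = (CLINT \<zeta>|std_gauss. char (distr M borel (\<lambda>\<omega>. ?f \<omega> \<zeta>)) 1)"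
    by (subst char_distr_one) auto
  finally show ?thesis .
qed

text \<open>Dominated convergence in \<open>\<zeta>\<close> with the constant bound 1: at
  \<open>t = sqrt (2 * s) *\<^sub>R \<zeta>\<close> the limit is
  \<open>exp (- s * |\<zeta>|^2)\<close>, whose Gaussian average is the Laplace transform of the
  chi-square law.\<close>

lemma laplace_norm_sq_tendsto:
  fixes Z :: "nat \<Rightarrow> 'a \<Rightarrow> real ^ 'l::finite"
  assumes Z[measurable]: "\<And>n. Z n \<in> borel_measurable M" and s: "0 \<le> s"
    and char: "\<And>t. (\<lambda>n. char (distr M borel (\<lambda>\<omega>. t \<bullet> Z n \<omega>)) 1) \<longlonglongrightarrow> exp (- (norm t)\<^sup>2 / 2)"
  shows "(\<lambda>n. expectation (\<lambda>\<omega>. exp (- s * (norm (Z n \<omega>))\<^sup>2)))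
    \<longlonglongrightarrow> (LINT x|chi_square CARD('l). exp (- s * x))"
proof -
  interpret G: prob_space "std_gauss :: ('l \<Rightarrow> real) measure"
    by (rule prob_space_std_gauss)
  have Zl: "(\<lambda>\<omega>. Z n \<omega> $ l) \<in> borel_measurable M" for n l
    by (rule measurable_compose[OF Z borel_measurable_nth])
  have comp: "(\<lambda>\<zeta>. \<zeta> l) \<in> borel_measurable (std_gauss :: ('l \<Rightarrow> real) measure)" for l
    unfolding std_gauss_def by measurable
  let ?t = "\<lambda>\<zeta>. sqrt (2 * s) *\<^sub>R (\<chi> l. \<zeta> l) :: real ^ 'l"
  have nt: "(norm (?t \<zeta>))\<^sup>2 = 2 * s * (\<Sum>l\<in>UNIV. (\<zeta> l)\<^sup>2)" for \<zeta>
    using s by (simp add: norm_vec_def L2_set_def sum_nonneg power_mult_distrib sum_distrib_left)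
  have "(\<lambda>n. CLINT \<zeta>|std_gauss. char (distr M borel (\<lambda>\<omega>. ?t \<zeta> \<bullet> Z n \<omega>)) 1)
      \<longlonglongrightarrow> (CLINT \<zeta>|std_gauss. complex_of_real (exp (- (norm (?t \<zeta>))\<^sup>2 / 2)))"
  proof (rule integral_dominated_convergence[where w = "\<lambda>_. 1"])
    show "(\<lambda>\<zeta>. complex_of_real (exp (- (norm (?t \<zeta>))\<^sup>2 / 2))) \<in> borel_measurable std_gauss"
      unfolding nt using comp by measurable
    \<comment> \<open>Measurability in the parameter is obtained by writing the characteristic
      function as a parametrised integral of a jointly measurable function.\<close>
    show "(\<lambda>\<zeta>. char (distr M borel (\<lambda>\<omega>. ?t \<zeta> \<bullet> Z n \<omega>)) 1) \<in> borel_measurable std_gauss" for n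
    proof -
      have "(\<lambda>x. \<Sum>l\<in>UNIV. sqrt (2 * s) * fst x l * Z n (snd x) $ l) \<in> borel_measurable (std_gauss \<Otimes>\<^sub>M M)"
        by (intro borel_measurable_sum borel_measurable_times borel_measurable_const
          measurable_compose[OF measurable_snd Zl] measurable_compose[OF measurable_fst comp])
      then have "(\<lambda>(\<zeta>, \<omega>). iexp (\<Sum>l\<in>UNIV. sqrt (2 * s) * \<zeta> l * Z n \<omega> $ l)) \<in> borel_measurable (std_gauss \<Otimes>\<^sub>M M)"
        unfolding case_prod_beta by measurable
      then have "(\<lambda>\<zeta>. CLINT \<omega>|M. iexp (\<Sum>l\<in>UNIV. sqrt (2 * s) * \<zeta> l * Z n \<omega> $ l)) \<in> borel_measurable std_gauss"
        by (rule borel_measurable_lebesgue_integral)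
      moreover have "char (distr M borel (\<lambda>\<omega>. ?t \<zeta> \<bullet> Z n \<omega>)) 1
          = (CLINT \<omega>|M. iexp (\<Sum>l\<in>UNIV. sqrt (2 * s) * \<zeta> l * Z n \<omega> $ l))" for \<zeta>
        using Zl by (subst char_distr_one) (auto simp: inner_vec_def)
      ultimately show ?thesis
        by simp
    qed
    show "AE \<zeta> in std_gauss. norm (char (distr M borel (\<lambda>\<omega>. ?t \<zeta> \<bullet> Z n \<omega>)) 1) \<le> 1" for n
      by (intro AE_I2 real_distribution.cmod_char_le_1 real_distribution_distr) measurable
    show "AE \<zeta> in std_gauss. (\<lambda>n. char (distr M borel (\<lambda>\<omega>. ?t \<zeta> \<bullet> Z n \<omega>)) 1)
        \<longlonglongrightarrow> complex_of_real (exp (- (norm (?t \<zeta>))\<^sup>2 / 2))"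
      by (intro AE_I2 char)
  qed simp
  then have "(\<lambda>n. complex_of_real (expectation (\<lambda>\<omega>. exp (- s * (norm (Z n \<omega>))\<^sup>2))))
      \<longlonglongrightarrow> complex_of_real (LINT \<zeta>|(std_gauss :: ('l \<Rightarrow> real) measure). exp (- s * (\<Sum>l\<in>UNIV. (\<zeta> l)\<^sup>2)))"
    by (simp only: laplace_norm_sq[OF Z s] nt integral_complex_of_real) simp
  then have "(\<lambda>n. expectation (\<lambda>\<omega>. exp (- s * (norm (Z n \<omega>))\<^sup>2)))
      \<longlonglongrightarrow> (LINT \<zeta>|(std_gauss :: ('l \<Rightarrow> real) measure). exp (- s * (\<Sum>l\<in>UNIV. (\<zeta> l)\<^sup>2)))"
    by (simp only: tendsto_of_real_iff)
  then show ?thesis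
    unfolding chi_square_eq_distr_std_gauss using comp by (subst integral_distr) auto
qed

text \<open>The moment criterion is applied to the image under \<open>exp (- x)\<close>. This map
  reverses the order, so distribution functions there become upper tails here, which is the form a
  rejection probability needs.\<close>

lemma norm_sq_tendsto_chi_square:
  fixes Z :: "nat \<Rightarrow> 'a \<Rightarrow> real ^ 'l::finite"
  assumes Z[measurable]: "\<And>n. Z n \<in> borel_measurable M"
    and char: "\<And>t. (\<lambda>n. char (distr M borel (\<lambda>\<omega>. t \<bullet> Z n \<omega>)) 1) \<longlonglongrightarrow> exp (- (norm t)\<^sup>2 / 2)"
  shows "(\<lambda>n. prob {\<omega> \<in> space M. y \<le> (norm (Z n \<omega>))\<^sup>2}) \<longlonglongrightarrow> 1 - cdf (chi_square CARD('l)) y"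
proof -
  interpret C: real_distribution "chi_square CARD('l)"
    by (rule real_distribution_chi_square)
  let ?\<mu> = "\<lambda>n. distr M borel (\<lambda>\<omega>. exp (- (norm (Z n \<omega>))\<^sup>2))"
  let ?\<nu> = "distr (chi_square CARD('l)) borel (\<lambda>x. exp (- x))"
  have nonneg: "AE x in chi_square CARD('l). 0 \<le> x"
    unfolding chi_square_def by (subst AE_distr_iff) (auto intro!: sum_nonneg)
  have null: "C.prob {y} = 0"
    by (rule chi_square_singleton) simp
  have "weak_conv_m ?\<mu> ?\<nu>"
  proof (rule weak_conv_m_of_moments)
    show "real_distribution (?\<mu> n)" for n
      by (intro real_distribution_distr) measurable
    show "real_distribution ?\<nu>"
      by (intro C.real_distribution_distr) measurable
    show "AE x in ?\<mu> n. x \<in> {0..1}" for n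
      by (subst AE_distr_iff) auto
    show "AE x in ?\<nu>. x \<in> {0..1}"
      using nonneg by (subst AE_distr_iff) (auto elim!: eventually_mono)
    show "(\<lambda>n. LINT x|?\<mu> n. x ^ k) \<longlonglongrightarrow> (LINT x|?\<nu>. x ^ k)" for k
      using laplace_norm_sq_tendsto[OF Z _ char, of "real k"]
      by (simp add: integral_distr exp_of_nat_mult[symmetric])
  qed
  moreover have "isCont (cdf ?\<nu>) (exp (- y))"
  proof -
    interpret V: real_distribution ?\<nu>
      by (intro C.real_distribution_distr) measurable
    have "measure ?\<nu> {exp (- y)} = C.prob {y}"
      by (subst measure_distr) (auto intro!: arg_cong[where f = C.prob])
    then show ?thesis
      by (simp add: V.isCont_cdf null)
  qed
  ultimately have "(\<lambda>n. cdf (?\<mu> n) (exp (- y))) \<longlonglongrightarrow> cdf ?\<nu> (exp (- y))"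
    unfolding weak_conv_m_def weak_conv_def by blast
  moreover have "cdf (?\<mu> n) (exp (- y)) = prob {\<omega> \<in> space M. y \<le> (norm (Z n \<omega>))\<^sup>2}" for n
    unfolding cdf_def by (subst measure_distr) (auto intro!: arg_cong[where f = prob])
  \<comment> \<open>The order-reversed event contains its end point \<open>y\<close>; absence of
    atoms removes it and leaves the complement of \<open>{..y}\<close>.\<close>
  moreover have "cdf ?\<nu> (exp (- y)) = 1 - cdf (chi_square CARD('l)) y"
  proof -
    have "cdf ?\<nu> (exp (- y)) = C.prob ({y} \<union> (UNIV - {..y}))"
      unfolding cdf_def by (subst measure_distr) (auto intro!: arg_cong[where f = C.prob])
    also have "\<dots> = C.prob {y} + C.prob (UNIV - {..y})"
      by (intro C.finite_measure_Union) auto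
    finally show ?thesis
      using C.prob_compl[of "{..y}"] by (simp add: null cdf_def)
  qed
  ultimately show ?thesis by simp
qed

end

section \<open>Matrices and quadratic forms\<close>

lemma matrix_inv_works:
  fixes A :: "real ^ 'n ^ 'n"
  assumes "invertible A"
  shows "A ** matrix_inv A = mat 1" "matrix_inv A ** A = mat 1"
  using assms someI_ex[of "\<lambda>B. A ** B = mat 1 \<and> B ** A = mat 1"]
  unfolding invertible_def matrix_inv_def by auto

text \<open>Cramer's rule with the \<open>j\<close>-th unit vector on the right. Expressing
  \<open>matrix_inv\<close>, which is defined by choice, through determinants gives access to its
  continuity.\<close>

lemma matrix_inv_entry:
  fixes A :: "real ^ 'n ^ 'n"
  assumes "invertible A"
  shows "matrix_inv A $ i $ j = det (\<chi> r c. if c = i then axis j 1 $ r else A $ r $ c) / det A"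
proof -
  have "A *v (matrix_inv A *v axis j 1) = axis j 1"
    using matrix_inv_works[OF assms] by (simp add: matrix_vector_mul_assoc)
  then have "matrix_inv A *v axis j 1 = (\<chi> k. det (\<chi> r c. if c = k then axis j 1 $ r else A $ r $ c) / det A)"
    using cramer assms invertible_det_nz by blast
  then have "(matrix_inv A *v axis j 1) $ i = det (\<chi> r c. if c = i then axis j 1 $ r else A $ r $ c) / det A"
    by simp
  then show ?thesis
    by (simp add: matrix_vector_mult_basis column_def)
qed

lemma tendsto_matrix_entries:
  fixes A :: "'a \<Rightarrow> real ^ 'n ^ 'm"
  shows "(A \<longlongrightarrow> B) F \<longleftrightarrow> (\<forall>i j. ((\<lambda>x. A x $ i $ j) \<longlongrightarrow> B $ i $ j) F)"
proof
  show "(A \<longlongrightarrow> B) F" if "\<forall>i j. ((\<lambda>x. A x $ i $ j) \<longlongrightarrow> B $ i $ j) F"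
    by (rule vec_tendstoI, rule vec_tendstoI) (use that in blast)
qed (simp add: tendsto_vec_nth)

lemma tendsto_det:
  fixes A :: "'a \<Rightarrow> real ^ 'n ^ 'n"
  assumes "(A \<longlongrightarrow> B) F"
  shows "((\<lambda>x. det (A x)) \<longlongrightarrow> det B) F"
  unfolding det_def by (intro tendsto_intros assms)

text \<open>Each entry of the inverse is a quotient of polynomials whose denominator has the nonzero
  limit \<open>det B\<close>. The quotient formula holds only at invertible matrices, hence along
  \<open>F\<close> only eventually.\<close>

lemma tendsto_matrix_inv:
  fixes A :: "'a \<Rightarrow> real ^ 'n ^ 'n"
  assumes A: "(A \<longlongrightarrow> B) F" and B: "invertible B"
  shows "eventually (\<lambda>x. invertible (A x)) F" "((\<lambda>x. matrix_inv (A x)) \<longlongrightarrow> matrix_inv B) F"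
proof -
  have "eventually (\<lambda>x. det (A x) \<noteq> 0) F"
    using tendsto_imp_eventually_ne[OF tendsto_det[OF A]] B invertible_det_nz by blast
  then show inv: "eventually (\<lambda>x. invertible (A x)) F"
    by (simp add: invertible_det_nz)
  have "((\<lambda>x. matrix_inv (A x) $ i $ j) \<longlongrightarrow> matrix_inv B $ i $ j) F" for i j
  proof -
    have "((\<lambda>x. det (\<chi> r c. if c = i then axis j 1 $ r else A x $ r $ c) / det (A x))
      \<longlongrightarrow> det (\<chi> r c. if c = i then axis j 1 $ r else B $ r $ c) / det B) F"
      using B A by (intro tendsto_divide tendsto_det A)
        (auto simp: invertible_det_nz tendsto_matrix_entries)
    then show ?thesis
      unfolding matrix_inv_entry[OF B]
      by (rule Lim_transform_eventually) (use inv in \<open>auto elim!: eventually_mono simp: matrix_inv_entry\<close>)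
  qed
  then show "((\<lambda>x. matrix_inv (A x)) \<longlongrightarrow> matrix_inv B) F"
    by (simp add: tendsto_matrix_entries)
qed

section \<open>Positive definite matrices and a factorization of the inverse\<close>

lemma dot_symmetric_matrix:
  fixes A :: "real ^ 'n ^ 'n"
  assumes "transpose A = A"
  shows "x \<bullet> (A *v y) = y \<bullet> (A *v x)"
  using dot_lmul_matrix[of x A y] assms by (metis inner_commute transpose_matrix_vector)

text \<open>A vector on which a semidefinite form vanishes lies in the kernel. Moving from
  \<open>x\<close> by \<open>r\<close> times \<open>y = A *v x\<close> changes the form by
  \<open>2 * r * (y \<bullet> y)\<close> to first order, which would be negative for small negative
  \<open>r\<close> unless \<open>y = 0\<close>.\<close>

lemma pos_def_of_psd_invertible:
  fixes A :: "real ^ 'n ^ 'n"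
  assumes sym: "transpose A = A" and psd: "\<And>x. 0 \<le> x \<bullet> (A *v x)" and inv: "invertible A" and x: "x \<noteq> 0"
  shows "0 < x \<bullet> (A *v x)"
proof (rule ccontr)
  assume "\<not> 0 < x \<bullet> (A *v x)"
  then have x0: "x \<bullet> (A *v x) = 0"
    using psd[of x] by simp
  define y where "y = A *v x"
  define q where "q = y \<bullet> (A *v y)"
  have expand: "(x + r *\<^sub>R y) \<bullet> (A *v (x + r *\<^sub>R y)) = 2 * r * (y \<bullet> y) + r\<^sup>2 * q" for r
    using x0 dot_symmetric_matrix[OF sym, of x y]
    by (simp add: matrix_vector_right_distrib matrix_vector_mult_scaleR inner_add_left inner_add_right
        power2_eq_square q_def y_def distrib_left mult.assoc)
  have "y \<bullet> y = 0"
  proof (rule ccontr)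
    assume "y \<bullet> y \<noteq> 0"
    then have y: "0 < y \<bullet> y" by simp
    have q: "0 \<le> q" by (simp add: q_def psd)
    \<comment> \<open>Roughly the minimiser \<open>- (y \<bullet> y) / q\<close> of the quadratic in
      \<open>r\<close>; the added 1 covers \<open>q = 0\<close>.\<close>
    let ?r = "- (y \<bullet> y) / (1 + q)"
    have "2 * ?r * (y \<bullet> y) + ?r\<^sup>2 * q = (y \<bullet> y)\<^sup>2 * (q / (1 + q) - 2) / (1 + q)"
      using q by (simp add: power2_eq_square divide_simps) (simp add: algebra_simps)
    also have "\<dots> < 0"
      using q y by (intro divide_neg_pos mult_pos_neg) (auto simp: divide_simps)
    finally show False
      using psd[of "x + ?r *\<^sub>R y"] expand[of ?r] by linarith
  qed
  then have "A *v x = 0"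
    by (simp add: y_def)
  then show False
    using inv x by (metis matrix_inv_works(2) matrix_vector_mul_assoc matrix_vector_mul_lid matrix_vector_mult_0_right)
qed

text \<open>Gram--Schmidt for the inner product given by \<open>A\<close>.\<close>

lemma conjugate_basis_exists:
  fixes A :: "real ^ 'n ^ 'n"
  assumes sym: "transpose A = A" and pd: "\<And>x. x \<noteq> 0 \<Longrightarrow> 0 < x \<bullet> (A *v x)" and S: "finite (S :: 'n set)"
  shows "\<exists>c. \<forall>i\<in>S. \<forall>j\<in>S. c i \<bullet> (A *v c j) = (if i = j then 1 else 0)"
  using S
proof (induction S)
  case empty
  then show ?case by simp
next
  case (insert k S)
  then obtain c where c: "\<And>i j. i \<in> S \<Longrightarrow> j \<in> S \<Longrightarrow> c i \<bullet> (A *v c j) = (if i = j then 1 else 0)"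
    by blast
  \<comment> \<open>Dimension count: the vectors chosen so far are fewer than the dimension of the
    space, so some \<open>x\<close> lies outside their span and its orthogonalised part
    \<open>y\<close> is nonzero.\<close>
  have "dim (c ` S) \<le> card (c ` S)"
    by (rule dim_le_card') (use insert in simp)
  also have "\<dots> \<le> card S"
    by (rule card_image_le) (use insert in simp)
  also have "\<dots> < card (UNIV :: 'n set)"
    using insert by (intro psubset_card_mono) auto
  also have "\<dots> = dim (UNIV :: (real ^ 'n) set)"
    by simp
  finally have "span (c ` S) \<noteq> UNIV"
    by (metis dim_span less_irrefl)
  then obtain x where x: "x \<notin> span (c ` S)"
    by blast
  define y where "y = x - (\<Sum>i\<in>S. (c i \<bullet> (A *v x)) *\<^sub>R c i)"
  have "(\<Sum>i\<in>S. (c i \<bullet> (A *v x)) *\<^sub>R c i) \<in> span (c ` S)"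
    by (intro span_sum span_scale span_base) auto
  then have y0: "y \<noteq> 0"
    using x by (auto simp: y_def)
  have orth: "c j \<bullet> (A *v y) = 0" if j: "j \<in> S" for j
  proof -
    have "c j \<bullet> (A *v y) = c j \<bullet> (A *v x) - (\<Sum>i\<in>S. (c i \<bullet> (A *v x)) * (c j \<bullet> (A *v c i)))"
      by (simp add: y_def matrix_vector_mult_diff_distrib inner_diff_right
          linear_sum[OF matrix_vector_mul_linear] inner_sum_right matrix_vector_mult_scaleR)
    also have "(\<Sum>i\<in>S. (c i \<bullet> (A *v x)) * (c j \<bullet> (A *v c i))) = (\<Sum>i\<in>S. if i = j then c i \<bullet> (A *v x) else 0)"
      using j by (intro sum.cong refl) (auto simp: c)
    finally show ?thesis
      using j insert by simp
  qed
  let ?q = "y \<bullet> (A *v y)"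
  define c' where "c' = c(k := (1 / sqrt ?q) *\<^sub>R y)"
  have q: "0 < ?q"
    by (rule pd[OF y0])
  have kk: "c' k \<bullet> (A *v c' k) = 1"
    using q by (simp add: c'_def matrix_vector_mult_scaleR)
  have jk: "c' j \<bullet> (A *v c' k) = 0" "c' k \<bullet> (A *v c' j) = 0" if "j \<in> S" for j
    using that insert orth[OF that] dot_symmetric_matrix[OF sym, of y "c j"]
    by (auto simp: c'_def matrix_vector_mult_scaleR)
  have jj: "c' i \<bullet> (A *v c' j) = (if i = j then 1 else 0)" if "i \<in> S" "j \<in> S" for i j
    using that insert c by (auto simp: c'_def)
  show ?case
    using kk jk jj insert by (intro exI[of _ c']) auto
qed

text \<open>The columns of \<open>C\<close> are a basis orthonormal for the form of
  \<open>A\<close>. For square matrices a one-sided inverse is two-sided, so the relation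
  \<open>transpose C ** A ** C = mat 1\<close> can be rotated into one saying that
  \<open>C ** transpose C\<close> inverts \<open>A\<close>.\<close>

lemma pos_def_inverse_factor:
  fixes A :: "real ^ 'n ^ 'n"
  assumes sym: "transpose A = A" and pd: "\<And>x. x \<noteq> 0 \<Longrightarrow> 0 < x \<bullet> (A *v x)"
  obtains C :: "real ^ 'n ^ 'n" where "transpose C ** A ** C = mat 1" "matrix_inv A = C ** transpose C"
proof -
  obtain c where c: "\<And>i j :: 'n. c i \<bullet> (A *v c j) = (if i = j then 1 else 0)"
    using conjugate_basis_exists[OF sym, of UNIV] pd by auto
  define C :: "real ^ 'n ^ 'n" where "C = (\<chi> i j. c j $ i)"
  have entry: "(transpose C ** (A ** C)) $ i $ j = c i \<bullet> (A *v c j)" for i j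
    by (simp add: C_def matrix_matrix_mult_def transpose_def inner_vec_def matrix_vector_mult_def)
  have 1: "transpose C ** A ** C = mat 1"
    unfolding matrix_mul_assoc[symmetric] vec_eq_iff entry c by (simp add: mat_def)
  then have "C ** (transpose C ** A) = mat 1"
    using matrix_left_right_inverse by blast
  then have l: "(C ** transpose C) ** A = mat 1"
    by (simp add: matrix_mul_assoc)
  then have r: "A ** (C ** transpose C) = mat 1"
    using matrix_left_right_inverse by blast
  then have "invertible A"
    using l invertible_def by blast
  then have "matrix_inv A ** A = mat 1"
    by (rule matrix_inv_works(2))
  then have "matrix_inv A = C ** transpose C"
    using r by (metis matrix_mul_assoc matrix_mul_lid matrix_mul_rid)
  with 1 show ?thesis
    using that by blast
qed

section \<open>The delta method\<close>

text \<open>The comparison sequences \<open>x'\<close> and \<open>y'\<close> are only bounded,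
  possibly divergent, so the product rule for limits does not apply; the product is expanded around
  them instead. This is the situation of the scaled error, which is bounded on the good event but
  has no limit along a sequence of data.\<close>

lemma tendsto_mult_diff_bounded:
  fixes x x' y y' :: "nat \<Rightarrow> real"
  assumes x: "(\<lambda>n. x n - x' n) \<longlonglongrightarrow> 0" and y: "(\<lambda>n. y n - y' n) \<longlonglongrightarrow> 0"
    and bd: "\<And>n. \<bar>x' n\<bar> \<le> B" "\<And>n. \<bar>y' n\<bar> \<le> C"
  shows "(\<lambda>n. x n * y n - x' n * y' n) \<longlonglongrightarrow> 0"
proof (rule Lim_null_comparison)
  let ?r = "\<lambda>n. \<bar>x n - x' n\<bar> * \<bar>y n - y' n\<bar> + B * \<bar>y n - y' n\<bar> + \<bar>x n - x' n\<bar> * C"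
  show "\<forall>\<^sub>F n in sequentially. norm (x n * y n - x' n * y' n) \<le> ?r n"
  proof (intro always_eventually allI)
    fix n
    have "x n * y n - x' n * y' n = (x n - x' n) * (y n - y' n) + x' n * (y n - y' n) + (x n - x' n) * y' n"
      by (simp add: algebra_simps)
    also have "\<bar>\<dots>\<bar> \<le> \<bar>(x n - x' n) * (y n - y' n)\<bar> + \<bar>x' n * (y n - y' n)\<bar> + \<bar>(x n - x' n) * y' n\<bar>"
      by linarith
    also have "\<dots> \<le> ?r n"
      unfolding abs_mult by (intro add_mono mult_left_mono mult_right_mono bd) auto
    finally show "norm (x n * y n - x' n * y' n) \<le> ?r n"
      by simp
  qed
  have "?r \<longlonglongrightarrow> \<bar>0\<bar> * \<bar>0\<bar> + B * \<bar>0\<bar> + \<bar>0\<bar> * C"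
    by (intro tendsto_intros x y)
  then show "?r \<longlonglongrightarrow> 0"
    by simp
qed

lemma quadratic_form_sum:
  fixes x :: "real ^ 'n" and A :: "real ^ 'n ^ 'n"
  shows "x \<bullet> (A *v x) = (\<Sum>i\<in>UNIV. \<Sum>j\<in>UNIV. A $ i $ j * (x $ i * x $ j))"
  by (simp add: inner_vec_def matrix_vector_mult_def sum_distrib_left ac_simps)

lemma tendsto_quadratic_form_diff:
  fixes w u :: "nat \<Rightarrow> real ^ 'n" and B :: "nat \<Rightarrow> real ^ 'n ^ 'n"
  assumes w: "(\<lambda>n. w n - u n) \<longlonglongrightarrow> 0" and u: "\<And>n. norm (u n) \<le> C" and B: "B \<longlonglongrightarrow> L"
  shows "(\<lambda>n. w n \<bullet> (B n *v w n) - u n \<bullet> (L *v u n)) \<longlonglongrightarrow> 0"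
proof -
  have ui: "\<bar>u n $ i\<bar> \<le> C" for n i
    using component_le_norm_cart[of "u n" i] u[of n] by simp
  have wi: "(\<lambda>n. w n $ i - u n $ i) \<longlonglongrightarrow> 0" for i
    using tendsto_vec_nth[OF w, of i] by simp
  have uu: "\<bar>u n $ i * u n $ j\<bar> \<le> C * C" for n i j
    unfolding abs_mult by (intro mult_mono ui) (use ui[of n i] in auto)
  have Bij: "(\<lambda>n. B n $ i $ j - L $ i $ j) \<longlonglongrightarrow> 0" for i j
    using B by (simp add: tendsto_matrix_entries LIM_zero)
  have "(\<lambda>n. \<Sum>i\<in>UNIV. \<Sum>j\<in>UNIV. B n $ i $ j * (w n $ i * w n $ j) - L $ i $ j * (u n $ i * u n $ j))
      \<longlonglongrightarrow> (\<Sum>i\<in>(UNIV :: 'n set). \<Sum>j\<in>(UNIV :: 'n set). 0)"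
    by (intro tendsto_sum tendsto_mult_diff_bounded[OF Bij _ order_refl uu]
        tendsto_mult_diff_bounded[OF wi wi ui ui])
  then show ?thesis
    by (simp add: quadratic_form_sum sum_subtractf)
qed

text \<open>Boundedness of the scaled deviation forces \<open>v n\<close> to \<open>y\<close> at
  rate \<open>1 / r n\<close>. The remainder of the derivative is small relative to
  \<open>norm (v n - y)\<close>, so it still vanishes after multiplication by \<open>r n\<close>.
  Because \<open>T y = 0\<close>, what survives is linear in the scaled deviation.\<close>

lemma delta_method_quadratic_form:
  fixes T :: "real ^ 'd \<Rightarrow> real ^ 'l" and r :: "nat \<Rightarrow> real"
  assumes der: "(T has_derivative (\<lambda>h. A *v h)) (at y)" and T0: "T y = 0"
    and r: "filterlim r at_top sequentially"
    and v: "\<And>n. norm (r n *\<^sub>R (v n - y)) \<le> K"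
    and B: "B \<longlonglongrightarrow> L"
  shows "(\<lambda>n. (r n)\<^sup>2 * (T (v n) \<bullet> (B n *v T (v n)))
    - (A *v (r n *\<^sub>R (v n - y))) \<bullet> (L *v (A *v (r n *\<^sub>R (v n - y))))) \<longlonglongrightarrow> 0"
proof -
  define w u where "w n = r n *\<^sub>R T (v n)" and "u n = A *v (r n *\<^sub>R (v n - y))" for n
  have K0: "0 \<le> K"
    using v[of 0] norm_ge_zero order_trans by blast
  have rpos: "\<forall>\<^sub>F n in sequentially. 0 < r n"
    using r unfolding filterlim_at_top_dense by blast
  have vy: "(\<lambda>n. norm (v n - y)) \<longlonglongrightarrow> 0"
  proof (rule Lim_null_comparison)
    show "\<forall>\<^sub>F n in sequentially. norm (norm (v n - y)) \<le> K * inverse (r n)"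
      using rpos
    proof eventually_elim
      case (elim n)
      then have "norm (r n *\<^sub>R (v n - y)) = r n * norm (v n - y)"
        by simp
      with v[of n] elim show ?case
        by (simp add: divide_inverse[symmetric] pos_le_divide_eq mult.commute)
    qed
    show "(\<lambda>n. K * inverse (r n)) \<longlonglongrightarrow> 0"
      by (rule tendsto_mult_right_zero) (rule tendsto_inverse_0_at_top[OF r])
  qed
  have "(\<lambda>n. w n - u n) \<longlonglongrightarrow> 0"
  proof (rule tendstoI)
    fix e :: real
    assume e: "0 < e"
    \<comment> \<open>\<open>K + 1\<close> stays positive when \<open>K = 0\<close>, and
      \<open>e' * K < e\<close> is the final bound.\<close>
    define e' where "e' = e / (2 * (K + 1))"
    have e': "0 < e'" "e' * K < e"
      using e K0 by (auto simp: e'_def divide_simps)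
    obtain d where d: "d > 0" and dT: "\<And>z. norm (z - y) < d \<Longrightarrow> norm (T z - T y - A *v (z - y)) \<le> e' * norm (z - y)"
      using der e'(1) unfolding has_derivative_at_alt by blast
    have "\<forall>\<^sub>F n in sequentially. norm (v n - y) < d"
      using order_tendstoD(2)[OF vy d] .
    with rpos show "\<forall>\<^sub>F n in sequentially. dist (w n - u n) 0 < e"
    proof eventually_elim
      case (elim n)
      have "w n - u n = r n *\<^sub>R (T (v n) - T y - A *v (v n - y))"
        unfolding w_def u_def T0 matrix_vector_mult_scaleR by (simp add: scaleR_diff_right)
      then have "norm (w n - u n) = r n * norm (T (v n) - T y - A *v (v n - y))"
        using elim by simp
      also have "\<dots> \<le> r n * (e' * norm (v n - y))"
        using elim by (intro mult_left_mono dT) auto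
      also have "\<dots> = e' * norm (r n *\<^sub>R (v n - y))"
        using elim by simp
      also have "\<dots> \<le> e' * K"
        using e' by (intro mult_left_mono v) auto
      finally show ?case
        using e'(2) by simp
    qed
  qed
  moreover have "norm (u n) \<le> onorm ((*v) A) * K" for n
  proof -
    have "norm (u n) \<le> onorm ((*v) A) * norm (r n *\<^sub>R (v n - y))"
      unfolding u_def by (rule onorm) simp
    also have "\<dots> \<le> onorm ((*v) A) * K"
      by (intro mult_left_mono v onorm_pos_le) simp
    finally show ?thesis .
  qed
  ultimately have "(\<lambda>n. w n \<bullet> (B n *v w n) - u n \<bullet> (L *v u n)) \<longlonglongrightarrow> 0"
    by (rule tendsto_quadratic_form_diff[OF _ _ B])
  then show ?thesis
    by (simp add: w_def u_def matrix_vector_mult_scaleR power2_eq_square mult.assoc)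
qed

lemma tendsto_matrix_mult:
  fixes A :: "'a \<Rightarrow> real ^ 'n ^ 'm" and B :: "'a \<Rightarrow> real ^ 'k ^ 'n"
  assumes "(A \<longlongrightarrow> A') F" "(B \<longlongrightarrow> B') F"
  shows "((\<lambda>x. A x ** B x) \<longlongrightarrow> A' ** B') F"
  using assms unfolding tendsto_matrix_entries matrix_matrix_mult_def
  by (auto intro!: tendsto_sum tendsto_mult)

lemma tendsto_transpose:
  fixes A :: "'a \<Rightarrow> real ^ 'n ^ 'm"
  assumes "(A \<longlongrightarrow> A') F"
  shows "((\<lambda>x. transpose (A x)) \<longlongrightarrow> transpose A') F"
  using assms unfolding tendsto_matrix_entries by (simp add: transpose_def)

text \<open>There is no probability here: the estimate is uniform over all data with a bounded
  scaled error and accurate moment estimates. Negation turns this uniformity into a single sequence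
  of bad data, along which ordinary limits of vectors and matrices give a contradiction.\<close>

lemma s_hat_approx:
  fixes T :: "real ^ 'd::finite \<Rightarrow> real ^ 'l::finite" and \<iota> :: "'k::finite \<Rightarrow> 'm::finite" and blk :: "'d \<Rightarrow> 'k"
    and e1 :: "nat \<Rightarrow> 'm \<Rightarrow> (nat \<Rightarrow> 'x) \<Rightarrow> real ^ 'd" and h :: "'m \<Rightarrow> real ^ 'd"
    and G :: "'m \<Rightarrow> real ^ 'd ^ 'd" and a b
  defines "y \<equiv> diag_stack \<iota> blk h"
  defines "D \<equiv> D_mat T y (Sigma_mat blk b a G h)"
  assumes T_diff: "T differentiable (at y)" and T0: "T y = 0"
    and U: "open U" "y \<in> U" "\<And>z. z \<in> U \<Longrightarrow> T differentiable (at z)" "continuous_on U (\<lambda>z. jacobian T (at z))"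
    and a: "\<And>r s k l. (\<lambda>N. alpha_coef \<iota> p N r s k l) \<longlonglongrightarrow> a r s k l"
    and b: "\<And>m k l. (\<lambda>N. beta_coef \<iota> p N m k l) \<longlonglongrightarrow> b m k l"
    and D: "invertible D" and \<epsilon>: "0 < \<epsilon>"
  shows "\<exists>\<eta>>0. \<exists>N0. \<forall>N\<ge>N0. \<forall>x.
    norm (sqrt (real N) *\<^sub>R (g_hat \<iota> blk p g N x - y)) \<le> K \<longrightarrow>
    (\<forall>k m. dist (block_vec blk k (e1 N m x)) (block_vec blk k (h m)) \<le> \<eta>) \<longrightarrow>
    (\<forall>k l m. dist (block_mat blk k l (e2 N m x)) (block_mat blk k l (G m)) \<le> \<eta>) \<longrightarrow>
    T differentiable (at (diag_stack \<iota> blk (\<lambda>m. e1 N m x))) \<and> invertible (D_hat \<iota> blk p T e1 e2 N x) \<and>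
    (let u = jacobian T (at y) *v (sqrt (real N) *\<^sub>R (g_hat \<iota> blk p g N x - y))
     in \<bar>s_hat \<iota> blk p g T e1 e2 N x - u \<bullet> (matrix_inv D *v u)\<bar> \<le> \<epsilon>)"
    (is "\<exists>\<eta>>0. \<exists>N0. \<forall>N\<ge>N0. \<forall>x. ?hyp \<eta> N x")
proof (rule ccontr)
  define Q where "Q \<eta> N x = ?hyp \<eta> N x" for \<eta> N x
  assume "\<not> ?thesis"
  then have "\<not> (\<exists>\<eta>>0. \<exists>N0. \<forall>N\<ge>N0. \<forall>x. Q \<eta> N x)"
    unfolding Q_def .
  moreover have "0 < inverse (real (Suc n))" for n
    by simp
  \<comment> \<open>The tolerance \<open>inverse (real (Suc n))\<close> and the threshold
    \<open>Suc n\<close> are coupled, so that along the extracted sequence the estimates converge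
    while the sample sizes tend to infinity.\<close>
  ultimately have "\<exists>N\<ge>Suc n. \<exists>x. \<not> Q (inverse (real (Suc n))) N x" for n
    by blast
  then obtain N x where N: "\<And>n. Suc n \<le> N n" and nQ: "\<And>n. \<not> Q (inverse (real (Suc n))) (N n) (x n)"
    by metis
  note nhyp = nQ[unfolded Q_def]
  define v where "v n = g_hat \<iota> blk p g (N n) (x n)" for n
  define yn where "yn n = diag_stack \<iota> blk (\<lambda>m. e1 (N n) m (x n))" for n
  define Dn where "Dn n = D_hat \<iota> blk p T e1 e2 (N n) (x n)" for n
  define u where "u n = jacobian T (at y) *v (sqrt (real (N n)) *\<^sub>R (v n - y))" for n
  have v: "norm (sqrt (real (N n)) *\<^sub>R (v n - y)) \<le> K"
    and e1: "\<And>k m. dist (block_vec blk k (e1 (N n) m (x n))) (block_vec blk k (h m)) \<le> inverse (real (Suc n))"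
    and e2: "\<And>k l m. dist (block_mat blk k l (e2 (N n) m (x n))) (block_mat blk k l (G m)) \<le> inverse (real (Suc n))"
    for n
    using nhyp[of n] by (auto simp: v_def)
  have bad: "\<not> (T differentiable (at (yn n)) \<and> invertible (Dn n) \<and>
      \<bar>s_hat \<iota> blk p g T e1 e2 (N n) (x n) - u n \<bullet> (matrix_inv D *v u n)\<bar> \<le> \<epsilon>)" for n
    using nhyp[of n] by (auto simp: v_def yn_def Dn_def u_def Let_def)
  have Ninf: "filterlim N at_top sequentially"
    by (rule filterlim_at_top_mono[OF filterlim_Suc]) (use N in auto)
  have Nsqrt: "filterlim (\<lambda>n. sqrt (real (N n))) at_top sequentially"
    by (rule filterlim_compose[OF sqrt_at_top filterlim_compose[OF filterlim_real_sequentially Ninf]])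
  have inv0: "(\<lambda>n. inverse (real (Suc n))) \<longlonglongrightarrow> 0"
    by (rule LIMSEQ_inverse_real_of_nat)
  \<comment> \<open>Coordinate \<open>i\<close> is controlled through its own block
    \<open>blk i\<close>; all other blocks are zero there.\<close>
  have e1i: "(\<lambda>n. e1 (N n) m (x n) $ i) \<longlonglongrightarrow> h m $ i" for m i
  proof (rule LIM_zero_cancel, rule Lim_null_comparison[OF _ inv0], intro always_eventually allI)
    fix n
    show "norm (e1 (N n) m (x n) $ i - h m $ i) \<le> inverse (real (Suc n))"
      using component_le_norm_cart[of "block_vec blk (blk i) (e1 (N n) m (x n)) - block_vec blk (blk i) (h m)" i]
        e1[of "blk i" n m] by (simp add: block_vec_def dist_norm)
  qed
  have e2i: "(\<lambda>n. e2 (N n) m (x n) $ i $ j) \<longlonglongrightarrow> G m $ i $ j" for m i j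
  proof (rule LIM_zero_cancel, rule Lim_null_comparison[OF _ inv0], intro always_eventually allI)
    fix n
    let ?d = "block_mat blk (blk i) (blk j) (e2 (N n) m (x n)) - block_mat blk (blk i) (blk j) (G m)"
    show "norm (e2 (N n) m (x n) $ i $ j - G m $ i $ j) \<le> inverse (real (Suc n))"
      using component_le_norm_cart[of "?d $ i" j] Finite_Cartesian_Product.norm_nth_le[of ?d i]
        e2[of "blk i" "blk j" n m] by (simp add: block_mat_def dist_norm)
  qed
  have yn: "yn \<longlonglongrightarrow> y"
    unfolding yn_def y_def diag_stack_def by (intro tendsto_vec_lambda e1i)
  have S: "(\<lambda>n. Sigma_mat blk (beta_coef \<iota> p (N n)) (alpha_coef \<iota> p (N n)) (\<lambda>m. e2 (N n) m (x n)) (\<lambda>m. e1 (N n) m (x n)))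
      \<longlonglongrightarrow> Sigma_mat blk b a G h"
    unfolding Sigma_mat_def
    by (intro tendsto_vec_lambda tendsto_intros e1i e2i filterlim_compose[OF a Ninf] filterlim_compose[OF b Ninf])
  have J: "(\<lambda>n. jacobian T (at (yn n))) \<longlonglongrightarrow> jacobian T (at y)"
    using U(1,2,4) continuous_on_eq_continuous_at yn
    by (intro isCont_tendsto_compose[of y "\<lambda>z. jacobian T (at z)"]) auto
  have Dn: "Dn \<longlonglongrightarrow> D"
    unfolding Dn_def D_def D_hat_def D_mat_def yn_def[symmetric]
    by (intro tendsto_matrix_mult tendsto_transpose J S)
  have der: "(T has_derivative (\<lambda>h. jacobian T (at y) *v h)) (at y)"
    using T_diff jacobian_works by blast
  have "(\<lambda>n. (sqrt (real (N n)))\<^sup>2 * (T (v n) \<bullet> (matrix_inv (Dn n) *v T (v n))) - u n \<bullet> (matrix_inv D *v u n)) \<longlonglongrightarrow> 0"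
    unfolding u_def
    by (rule delta_method_quadratic_form[OF der T0 Nsqrt v tendsto_matrix_inv(2)[OF Dn D]])
  then have "(\<lambda>n. s_hat \<iota> blk p g T e1 e2 (N n) (x n) - u n \<bullet> (matrix_inv D *v u n)) \<longlonglongrightarrow> 0"
    by (simp add: s_hat_def Dn_def v_def)
  then have "\<forall>\<^sub>F n in sequentially. \<bar>s_hat \<iota> blk p g T e1 e2 (N n) (x n) - u n \<bullet> (matrix_inv D *v u n)\<bar> < \<epsilon>"
    using \<epsilon> by (auto simp: tendsto_iff)
  moreover have "\<forall>\<^sub>F n in sequentially. invertible (Dn n)"
    by (rule tendsto_matrix_inv(1)[OF Dn D])
  moreover have "\<forall>\<^sub>F n in sequentially. T differentiable (at (yn n))"
    using topological_tendstoD[OF yn U(1,2)] by eventually_elim (rule U(3))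
  ultimately have "\<forall>\<^sub>F n in sequentially. False"
    by eventually_elim (use bad in force)
  then show False
    by simp
qed

section \<open>The mixture model\<close>

lemma avg_sum: "avg N (\<lambda>j. \<Sum>i\<in>I. u i j) = (\<Sum>i\<in>I. avg N (u i))"
  unfolding avg_def by (subst sum.swap) (rule sum_distrib_left)

lemma avg_cmult: "avg N (\<lambda>j. c * u j) = c * avg N u"
  by (simp add: avg_def sum_distrib_left mult.left_commute)

lemma avg_diff: "avg N (\<lambda>j. u j - v j) = avg N u - avg N v"
  by (simp add: avg_def sum_subtractf right_diff_distrib)

text \<open>The entries of \<open>Gamma_mat p N ** matrix_inv (Gamma_mat p N)\<close>. This
  biorthogonality makes each weighted average an unbiased estimator of the moment of one
  component.\<close>

lemma avg_weight_p:
  assumes "invertible (Gamma_mat p N)"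
  shows "avg N (\<lambda>j. weight p N m j * p N i j) = (if i = m then 1 else 0)"
proof -
  have "avg N (\<lambda>j. weight p N m j * p N i j)
      = avg N (\<lambda>j. \<Sum>r\<in>UNIV. matrix_inv (Gamma_mat p N) $ r $ m * (p N i j * p N r j))"
    unfolding weight_def sum_distrib_right by (simp add: ac_simps)
  also have "\<dots> = (\<Sum>r\<in>UNIV. Gamma_mat p N $ i $ r * matrix_inv (Gamma_mat p N) $ r $ m)"
    unfolding avg_sum avg_cmult by (simp add: Gamma_mat_def mult.commute)
  also have "\<dots> = (Gamma_mat p N ** matrix_inv (Gamma_mat p N)) $ i $ m"
    by (simp add: matrix_matrix_mult_def)
  finally show ?thesis
    by (simp add: matrix_inv_works[OF assms] mat_def)
qed

text \<open>For each observation the concentrations are convex coefficients, so a weight is a convex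
  combination of entries of the inverse matrix; these converge and are therefore eventually
  bounded.\<close>

lemma weight_bounded:
  fixes p :: "nat \<Rightarrow> 'm::finite \<Rightarrow> nat \<Rightarrow> real"
  assumes p: "\<And>N m j. N \<ge> 1 \<Longrightarrow> j \<in> {1..N} \<Longrightarrow> 0 \<le> p N m j"
      "\<And>N j. N \<ge> 1 \<Longrightarrow> j \<in> {1..N} \<Longrightarrow> (\<Sum>m\<in>UNIV. p N m j) = 1"
    and \<Gamma>: "(\<lambda>N. Gamma_mat p N) \<longlonglongrightarrow> \<Gamma>" "invertible \<Gamma>"
  obtains B where "0 \<le> B" "\<forall>\<^sub>F N in sequentially. \<forall>m. \<forall>j\<in>{1..N}. \<bar>weight p N m j\<bar> \<le> B"
proof
  let ?I = "\<lambda>N. matrix_inv (Gamma_mat p N)"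
  \<comment> \<open>The summand 1 is slack for entries that are only near their limits; summing over
    all of them replaces a maximum.\<close>
  define B where "B = (\<Sum>i\<in>UNIV. \<Sum>m\<in>UNIV. \<bar>matrix_inv \<Gamma> $ i $ m\<bar> + 1)"
  show B0: "0 \<le> B"
    unfolding B_def by (intro sum_nonneg) auto
  have "\<forall>\<^sub>F N in sequentially. \<bar>?I N $ i $ m\<bar> < \<bar>matrix_inv \<Gamma> $ i $ m\<bar> + 1" for i m
    using tendsto_matrix_inv(2)[OF \<Gamma>]
    by (intro order_tendstoD(2)[of _ "\<bar>matrix_inv \<Gamma> $ i $ m\<bar>"]) (auto intro!: tendsto_intros)
  then have "\<forall>\<^sub>F N in sequentially. \<forall>i m. \<bar>?I N $ i $ m\<bar> < \<bar>matrix_inv \<Gamma> $ i $ m\<bar> + 1"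
    by (simp add: eventually_all_finite)
  then show "\<forall>\<^sub>F N in sequentially. \<forall>m. \<forall>j\<in>{1..N}. \<bar>weight p N m j\<bar> \<le> B"
    using eventually_ge_at_top[of 1]
  proof eventually_elim
    case (elim N)
    show ?case
    proof (intro allI ballI)
      fix m j
      assume j: "j \<in> {1..N}"
      have "\<bar>weight p N m j\<bar> \<le> (\<Sum>i\<in>UNIV. \<bar>p N i j * ?I N $ i $ m\<bar>)"
        unfolding weight_def by (rule sum_abs)
      also have "\<dots> \<le> (\<Sum>i\<in>UNIV. p N i j * B)"
      proof (intro sum_mono)
        fix i
        have "\<bar>?I N $ i $ m\<bar> \<le> \<bar>matrix_inv \<Gamma> $ i $ m\<bar> + 1"
          using elim by (simp add: less_imp_le)
        also have "\<dots> \<le> (\<Sum>m\<in>UNIV. \<bar>matrix_inv \<Gamma> $ i $ m\<bar> + 1)"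
          by (rule member_le_sum) auto
        also have "\<dots> \<le> B"
          unfolding B_def by (rule member_le_sum) (auto intro: sum_nonneg)
        finally show "\<bar>p N i j * ?I N $ i $ m\<bar> \<le> p N i j * B"
          using p(1)[OF elim(2) j] by (simp add: abs_mult mult_left_mono)
      qed
      also have "\<dots> = B"
        using p(2)[OF elim(2) j] by (simp add: sum_distrib_right[symmetric])
      finally show "\<bar>weight p N m j\<bar> \<le> B" .
    qed
  qed
qed

text \<open>Only the sampling scheme and the moments enter: the scaled error is analysed before
  \<open>T\<close> and the plug-in estimators appear.\<close>

locale mixture_sample = prob_space P
  for P :: "'w measure" +
  fixes X :: "'x measure"
    and F :: "'m::finite \<Rightarrow> 'x measure"
    and p :: "nat \<Rightarrow> 'm \<Rightarrow> nat \<Rightarrow> real"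
    and \<xi> :: "nat \<Rightarrow> nat \<Rightarrow> 'w \<Rightarrow> 'x"
    and \<iota> :: "'k::finite \<Rightarrow> 'm"
    and blk :: "'d::finite \<Rightarrow> 'k"
    and g :: "'x \<Rightarrow> real ^ 'd"
  assumes F: "\<And>m. prob_space (F m)" "\<And>m. sets (F m) = sets X"
    and p: "\<And>N m j. N \<ge> 1 \<Longrightarrow> j \<in> {1..N} \<Longrightarrow> p N m j \<ge> 0"
      "\<And>N j. N \<ge> 1 \<Longrightarrow> j \<in> {1..N} \<Longrightarrow> (\<Sum>m\<in>UNIV. p N m j) = 1"
    and \<xi>_indep: "\<And>N. N \<ge> 1 \<Longrightarrow> indep_vars (\<lambda>_. X) (\<xi> N) {1..N}"
    and \<xi>_law: "\<And>N j A. N \<ge> 1 \<Longrightarrow> j \<in> {1..N} \<Longrightarrow> A \<in> sets X \<Longrightarrow>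
      prob {\<omega> \<in> space P. \<xi> N j \<omega> \<in> A} = (\<Sum>m\<in>UNIV. p N m j * measure (F m) A)"
    and g: "g \<in> borel_measurable X"
    and moments: "\<And>m i. integrable (F m) (\<lambda>x. g x $ i)"
      "\<And>m i j. integrable (F m) (\<lambda>x. g x $ i * g x $ j)"
begin

abbreviation "M1 m \<equiv> moment1 (F m) g"
abbreviation "M2 m \<equiv> moment2 (F m) g"

definition "moment_vec = diag_stack \<iota> blk M1"
definition "mean N j i = (\<Sum>m\<in>UNIV. p N m j * M1 m $ i)"
definition "err N \<omega> = sqrt (real N) *\<^sub>R (g_hat \<iota> blk p g N (sample \<xi> N \<omega>) - moment_vec)"
text \<open>Finite-sample coefficients combined with the true moments;
  \<open>second_moment_err\<close> identifies this as the second-moment matrix of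
  \<open>err N\<close>.\<close>

definition "S N = Sigma_mat blk (beta_coef \<iota> p N) (alpha_coef \<iota> p N) M2 M1"
text \<open>Contribution of observation \<open>j\<close> to
  \<open>c \<bullet> err N \<omega>\<close>, kept as a function of the observed value
  \<open>x\<close> so that independence and the mixture formula apply directly.\<close>

definition "summand c N j x
  = (\<Sum>i\<in>UNIV. c $ i * weight p N (\<iota> (blk i)) j * (g x $ i - mean N j i)) / sqrt (real N)"

lemma \<xi>_measurable: "N \<ge> 1 \<Longrightarrow> j \<in> {1..N} \<Longrightarrow> \<xi> N j \<in> measurable P X"
  using \<xi>_indep by (simp add: indep_vars_def2)

lemma g_nth: "(\<lambda>x. g x $ i) \<in> borel_measurable X"
  by (rule measurable_compose[OF g borel_measurable_nth])

lemma summand_measurable: "summand c N j \<in> borel_measurable X"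
  unfolding summand_def using g_nth by measurable

lemma expectation_mixture:
  fixes f :: "'x \<Rightarrow> real"
  assumes N: "N \<ge> 1" "j \<in> {1..N}" and f: "f \<in> borel_measurable X" "\<And>m. integrable (F m) f"
  shows "integrable P (\<lambda>\<omega>. f (\<xi> N j \<omega>))"
    "expectation (\<lambda>\<omega>. f (\<xi> N j \<omega>)) = (\<Sum>m\<in>UNIV. p N m j * (LINT x|F m. f x))"
proof -
  have rv[measurable]: "\<xi> N j \<in> measurable P X"
    by (rule \<xi>_measurable[OF N])
  have mix: "emeasure (distr P X (\<xi> N j)) A = (\<Sum>m\<in>UNIV. ennreal (p N m j) * emeasure (F m) A)"
    if A: "A \<in> sets (distr P X (\<xi> N j))" for A
  proof -
    have [measurable]: "A \<in> sets X"
      using A by simp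
    have "emeasure (distr P X (\<xi> N j)) A = ennreal (prob {\<omega> \<in> space P. \<xi> N j \<omega> \<in> A})"
      by (subst emeasure_distr) (auto simp: emeasure_eq_measure vimage_def Int_def conj_commute)
    also have "\<dots> = (\<Sum>m\<in>UNIV. ennreal (p N m j * measure (F m) A))"
      by (subst \<xi>_law[OF N]) (auto simp: sum_ennreal p(1)[OF N])
    also have "\<dots> = (\<Sum>m\<in>UNIV. ennreal (p N m j) * emeasure (F m) A)"
      using F(1) by (intro sum.cong refl)
        (simp add: ennreal_mult p(1)[OF N] prob_space_def finite_measure.emeasure_eq_measure)
    finally show ?thesis .
  qed
  have "integrable (distr P X (\<xi> N j)) f"
    "(LINT x|distr P X (\<xi> N j). f x) = (\<Sum>m\<in>UNIV. p N m j * (LINT x|F m. f x))"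
    using integral_mixture[of UNIV F "distr P X (\<xi> N j)" "\<lambda>m. p N m j" f] f F(2) p(1)[OF N] mix by auto
  then show "integrable P (\<lambda>\<omega>. f (\<xi> N j \<omega>))"
    "expectation (\<lambda>\<omega>. f (\<xi> N j \<omega>)) = (\<Sum>m\<in>UNIV. p N m j * (LINT x|F m. f x))"
    using f(1) by (auto simp: integrable_distr_eq integral_distr)
qed

lemma integrable_F_const: "integrable (F m) (\<lambda>x. c :: real)"
  using F(1)[of m] by (simp add: prob_space_def finite_measure.integrable_const)

lemma integrable_centered:
  "integrable (F m) (\<lambda>x. g x $ i - a)" "integrable (F m) (\<lambda>x. (g x $ i - a) * (g x $ j - b))"
proof -
  show "integrable (F m) (\<lambda>x. g x $ i - a)"
    by (intro Bochner_Integration.integrable_diff moments integrable_F_const)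
  have "(\<lambda>x. (g x $ i - a) * (g x $ j - b)) = (\<lambda>x. g x $ i * g x $ j - b * g x $ i - a * g x $ j + a * b)"
    by (auto simp: algebra_simps)
  then show "integrable (F m) (\<lambda>x. (g x $ i - a) * (g x $ j - b))"
    by (simp only:) (intro Bochner_Integration.integrable_diff Bochner_Integration.integrable_add
        integrable_mult_right moments integrable_F_const)
qed

lemma summand_square:
  "(summand c N j x)\<^sup>2 = (\<Sum>i\<in>UNIV. \<Sum>i'\<in>UNIV. c $ i * c $ i' / real N
    * (weight p N (\<iota> (blk i)) j * weight p N (\<iota> (blk i')) j)
    * ((g x $ i - mean N j i) * (g x $ i' - mean N j i')))"
  unfolding summand_def power_divide
  by (simp add: power2_eq_square[of "sum _ _"] sum_product sum_divide_distrib ac_simps)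

lemma integrable_summand_square: "integrable (F m) (\<lambda>x. (summand c N j x)\<^sup>2)"
  unfolding summand_square
  by (intro Bochner_Integration.integrable_sum integrable_mult_right integrable_centered)

lemma expectation_g:
  assumes N: "N \<ge> 1" "j \<in> {1..N}"
  shows "integrable P (\<lambda>\<omega>. g (\<xi> N j \<omega>) $ i)" "expectation (\<lambda>\<omega>. g (\<xi> N j \<omega>) $ i) = mean N j i"
  using expectation_mixture[OF N g_nth moments(1)] by (auto simp: mean_def moment1_def)

lemma expectation_summand:
  assumes N: "N \<ge> 1" "j \<in> {1..N}"
  shows "expectation (\<lambda>\<omega>. summand c N j (\<xi> N j \<omega>)) = 0"
proof -
  have "expectation (\<lambda>\<omega>. summand c N j (\<xi> N j \<omega>)) = (\<Sum>i\<in>UNIV. c $ i * weight p N (\<iota> (blk i)) j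
      * expectation (\<lambda>\<omega>. g (\<xi> N j \<omega>) $ i - mean N j i)) / sqrt (real N)"
    unfolding summand_def integral_divide_zero
    by (subst Bochner_Integration.integral_sum)
      (auto intro!: integrable_mult_right Bochner_Integration.integrable_diff expectation_g[OF N])
  moreover have "expectation (\<lambda>\<omega>. g (\<xi> N j \<omega>) $ i - mean N j i) = 0" for i
    by (subst Bochner_Integration.integral_diff) (auto simp: expectation_g[OF N] prob_space)
  ultimately show ?thesis by simp
qed

text \<open>The subtracted double sum is the product of the two means, left expanded because its
  factors \<open>p N r j * p N s j\<close> turn into the \<alpha> coefficients on averaging.\<close>

lemma covariance_g:
  assumes N: "N \<ge> 1" "j \<in> {1..N}"
  shows "integrable P (\<lambda>\<omega>. (g (\<xi> N j \<omega>) $ i - mean N j i) * (g (\<xi> N j \<omega>) $ i' - mean N j i'))" (is ?int)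
    "expectation (\<lambda>\<omega>. (g (\<xi> N j \<omega>) $ i - mean N j i) * (g (\<xi> N j \<omega>) $ i' - mean N j i'))
      = (\<Sum>m\<in>UNIV. p N m j * M2 m $ i $ i')
        - (\<Sum>r\<in>UNIV. \<Sum>s\<in>UNIV. p N r j * p N s j * (M1 r $ i * M1 s $ i'))" (is ?eq)
proof -
  have m: "(\<lambda>x. g x $ i * g x $ i') \<in> borel_measurable X"
    by (intro borel_measurable_times g_nth)
  note prod = expectation_mixture[OF N m moments(2)]
  have expand: "(\<lambda>\<omega>. (g (\<xi> N j \<omega>) $ i - mean N j i) * (g (\<xi> N j \<omega>) $ i' - mean N j i'))
    = (\<lambda>\<omega>. g (\<xi> N j \<omega>) $ i * g (\<xi> N j \<omega>) $ i' - mean N j i' * g (\<xi> N j \<omega>) $ i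
        - mean N j i * g (\<xi> N j \<omega>) $ i' + mean N j i * mean N j i')"
    by (auto simp: algebra_simps)
  show ?int
    unfolding expand by (intro Bochner_Integration.integrable_diff Bochner_Integration.integrable_add
        integrable_mult_right prod expectation_g[OF N] integrable_const)
  have "expectation (\<lambda>\<omega>. (g (\<xi> N j \<omega>) $ i - mean N j i) * (g (\<xi> N j \<omega>) $ i' - mean N j i'))
    = expectation (\<lambda>\<omega>. g (\<xi> N j \<omega>) $ i * g (\<xi> N j \<omega>) $ i') - mean N j i * mean N j i'"
    unfolding expand using prod(1) expectation_g[OF N] by (simp add: prob_space)
  then show ?eq
    unfolding prod(2) by (simp add: mean_def moment2_def sum_product ac_simps)
qed

text \<open>Averaging the covariances of the observations against products of weights turns the
  factors \<open>p\<close> into \<beta> coefficients and the factors \<open>p * p\<close> into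
  \<alpha> coefficients.\<close>

lemma sum_variance_summand:
  assumes N: "N \<ge> 1"
  shows "(\<Sum>j=1..N. expectation (\<lambda>\<omega>. (summand c N j (\<xi> N j \<omega>))\<^sup>2)) = c \<bullet> (S N *v c)"
proof -
  let ?w = "\<lambda>i j. weight p N (\<iota> (blk i)) j"
  let ?C = "\<lambda>i i' j. (\<Sum>m\<in>UNIV. p N m j * M2 m $ i $ i')
        - (\<Sum>r\<in>UNIV. \<Sum>s\<in>UNIV. p N r j * p N s j * (M1 r $ i * M1 s $ i'))"
  have "expectation (\<lambda>\<omega>. (summand c N j (\<xi> N j \<omega>))\<^sup>2)
    = (\<Sum>i\<in>UNIV. \<Sum>i'\<in>UNIV. c $ i * c $ i' / real N * (?w i j * ?w i' j) * ?C i i' j)"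
    if j: "j \<in> {1..N}" for j
  proof -
    note int = integrable_mult_right[OF covariance_g(1)[OF N j]]
    show ?thesis
      unfolding summand_square
      by (subst Bochner_Integration.integral_sum, intro Bochner_Integration.integrable_sum int)
        (intro sum.cong refl, subst Bochner_Integration.integral_sum, intro int,
          simp add: covariance_g(2)[OF N j])
  qed
  then have "(\<Sum>j=1..N. expectation (\<lambda>\<omega>. (summand c N j (\<xi> N j \<omega>))\<^sup>2))
    = (\<Sum>j=1..N. \<Sum>i\<in>UNIV. \<Sum>i'\<in>UNIV. c $ i * c $ i' / real N * (?w i j * ?w i' j) * ?C i i' j)"
    by simp
  also have "\<dots> = avg N (\<lambda>j. \<Sum>i\<in>UNIV. \<Sum>i'\<in>UNIV. c $ i * c $ i' * (?w i j * ?w i' j * ?C i i' j))"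
    unfolding avg_def sum_distrib_left by (intro sum.cong refl) (simp add: ac_simps)
  also have "\<dots> = (\<Sum>i\<in>UNIV. \<Sum>i'\<in>UNIV. c $ i * c $ i' * avg N (\<lambda>j. ?w i j * ?w i' j * ?C i i' j))"
    unfolding avg_sum avg_cmult ..
  finally have "(\<Sum>j=1..N. expectation (\<lambda>\<omega>. (summand c N j (\<xi> N j \<omega>))\<^sup>2))
    = (\<Sum>i\<in>UNIV. \<Sum>i'\<in>UNIV. c $ i * c $ i' * avg N (\<lambda>j. ?w i j * ?w i' j * ?C i i' j))" .
  moreover have "avg N (\<lambda>j. ?w i j * ?w i' j * ?C i i' j) = S N $ i $ i'" for i i'
  proof -
    have "(\<lambda>j. ?w i j * ?w i' j * ?C i i' j)
      = (\<lambda>j. (\<Sum>m\<in>UNIV. M2 m $ i $ i' * (?w i j * ?w i' j * p N m j))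
          - (\<Sum>r\<in>UNIV. \<Sum>s\<in>UNIV. M1 r $ i * M1 s $ i' * (?w i j * ?w i' j * p N r j * p N s j)))"
      by (auto simp: right_diff_distrib sum_distrib_left ac_simps)
    then show ?thesis
      unfolding S_def Sigma_mat_def beta_coef_def alpha_coef_def
      by (simp only: avg_diff avg_sum avg_cmult) (simp add: ac_simps)
  qed
  ultimately show ?thesis
    by (simp add: quadratic_form_sum ac_simps)
qed

lemma g_hat_sample:
  "g_hat \<iota> blk p g N (sample \<xi> N \<omega>) $ i = avg N (\<lambda>j. weight p N (\<iota> (blk i)) j * g (\<xi> N j \<omega>) $ i)"
  by (simp add: g_hat_def diag_stack_def sample_def avg_def)

text \<open>By \<open>avg_weight_p\<close>, the weighted average of the means of the observations is
  exactly the vector of true moments, so the centering can be distributed over the observations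
  without any bias term.\<close>

lemma err_eq_sum:
  assumes N: "N \<ge> 1" and inv: "invertible (Gamma_mat p N)"
  shows "c \<bullet> err N \<omega> = (\<Sum>j=1..N. summand c N j (\<xi> N j \<omega>))"
proof -
  let ?w = "\<lambda>i j. weight p N (\<iota> (blk i)) j"
  have moment_vec: "moment_vec $ i = avg N (\<lambda>j. ?w i j * mean N j i)" for i
  proof -
    have "avg N (\<lambda>j. ?w i j * mean N j i) = avg N (\<lambda>j. \<Sum>m\<in>UNIV. M1 m $ i * (?w i j * p N m j))"
      unfolding mean_def sum_distrib_left by (simp add: ac_simps)
    also have "\<dots> = (\<Sum>m\<in>UNIV. M1 m $ i * (if m = \<iota> (blk i) then 1 else 0))"
      unfolding avg_sum avg_cmult avg_weight_p[OF inv] ..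
    also have "\<dots> = moment_vec $ i"
      by (simp add: moment_vec_def diag_stack_def if_distrib[of "(*) _"] cong: if_cong)
    finally show ?thesis ..
  qed
  have "c \<bullet> err N \<omega> = (\<Sum>i\<in>UNIV. c $ i * (sqrt (real N) * avg N (\<lambda>j. ?w i j * (g (\<xi> N j \<omega>) $ i - mean N j i))))"
    by (simp add: inner_vec_def err_def g_hat_sample moment_vec avg_diff right_diff_distrib)
  also have "\<dots> = sqrt (real N) * avg N (\<lambda>j. \<Sum>i\<in>UNIV. c $ i * (?w i j * (g (\<xi> N j \<omega>) $ i - mean N j i)))"
    unfolding avg_sum avg_cmult sum_distrib_left by (simp add: ac_simps)
  also have "\<dots> = (\<Sum>j=1..N. summand c N j (\<xi> N j \<omega>))"
    using N unfolding avg_def summand_def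
    by (simp add: sum_divide_distrib[symmetric] real_div_sqrt divide_simps ac_simps)
  finally show ?thesis .
qed

end

section \<open>Central limit theorem and tightness for the scaled error\<close>

context mixture_sample
begin

lemma err_measurable: "err N \<in> borel_measurable P"
proof -
  have "(\<lambda>\<omega>. err N \<omega> $ i) \<in> borel_measurable P" for i
  proof -
    have "(\<lambda>\<omega>. g (\<xi> N j \<omega>) $ i) \<in> borel_measurable P" if "j \<in> {1..N}" for j
      using that by (intro measurable_compose[OF \<xi>_measurable g_nth]) auto
    then have "(\<lambda>\<omega>. sqrt (real N) * (avg N (\<lambda>j. weight p N (\<iota> (blk i)) j * g (\<xi> N j \<omega>) $ i) - moment_vec $ i)) \<in> borel_measurable P"
      unfolding avg_def by (intro borel_measurable_times borel_measurable_diff borel_measurable_sum borel_measurable_const)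
    then show ?thesis
      by (simp add: err_def g_hat_sample)
  qed
  then show ?thesis
    by (subst borel_measurable_euclidean_space) (auto simp: Basis_vec_def inner_axis)
qed

lemma indep_summand: "N \<ge> 1 \<Longrightarrow> indep_vars (\<lambda>_. borel) (\<lambda>j \<omega>. summand c N j (\<xi> N j \<omega>)) {1..N}"
  by (rule indep_vars_compose2[OF \<xi>_indep summand_measurable])

lemma integrable_summand_sq:
  assumes N: "N \<ge> 1" "j \<in> {1..N}"
  shows "integrable P (\<lambda>\<omega>. (summand c N j (\<xi> N j \<omega>))\<^sup>2)"
  by (rule expectation_mixture(1)[OF N, of "\<lambda>x. (summand c N j x)\<^sup>2"])
    (use summand_measurable integrable_summand_square in auto)

lemma second_moment_err:
  assumes N: "N \<ge> 1" and inv: "invertible (Gamma_mat p N)"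
  shows "integrable P (\<lambda>\<omega>. (c \<bullet> err N \<omega>)\<^sup>2)" "expectation (\<lambda>\<omega>. (c \<bullet> err N \<omega>)\<^sup>2) = c \<bullet> (S N *v c)"
  unfolding err_eq_sum[OF N inv] sum_variance_summand[OF N, symmetric]
  by (intro second_moment_indep_sum indep_summand N integrable_summand_sq expectation_summand; simp)+

lemma mean_le:
  assumes N: "N \<ge> 1" "j \<in> {1..N}"
  shows "\<bar>mean N j i\<bar> \<le> (\<Sum>m\<in>UNIV. \<bar>M1 m $ i\<bar>)"
proof -
  have p1: "p N m j \<le> 1" for m
    using member_le_sum[of m UNIV "\<lambda>m. p N m j"] p(1)[OF N] p(2)[OF N] by simp
  have "\<bar>mean N j i\<bar> \<le> (\<Sum>m\<in>UNIV. \<bar>p N m j * M1 m $ i\<bar>)"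
    unfolding mean_def by (rule sum_abs)
  also have "\<dots> \<le> (\<Sum>m\<in>UNIV. \<bar>M1 m $ i\<bar>)"
    using p1 p(1)[OF N] by (intro sum_mono) (simp add: abs_mult mult_left_le_one_le)
  finally show ?thesis .
qed

text \<open>Replacing the concentrations by 1 gives a bound free of \<open>N\<close> and
  \<open>j\<close>, so that a single dominated convergence argument serves the whole array.\<close>

lemma expectation_le_sum:
  fixes f :: "'x \<Rightarrow> real"
  assumes N: "N \<ge> 1" "j \<in> {1..N}" and f: "f \<in> borel_measurable X" "\<And>m. integrable (F m) f" "\<And>x. 0 \<le> f x"
  shows "expectation (\<lambda>\<omega>. f (\<xi> N j \<omega>)) \<le> (\<Sum>m\<in>UNIV. LINT x|F m. f x)"
proof -
  have p1: "p N m j \<le> 1" for m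
    using member_le_sum[of m UNIV "\<lambda>m. p N m j"] p(1)[OF N] p(2)[OF N] by simp
  show ?thesis
    unfolding expectation_mixture(2)[OF N f(1,2)]
    using p1 p(1)[OF N] f(3) by (intro sum_mono mult_left_le_one_le) auto
qed

lemma summand_dominated:
  assumes \<Gamma>: "(\<lambda>N. Gamma_mat p N) \<longlonglongrightarrow> \<Gamma>" "invertible \<Gamma>"
  obtains W where "W \<in> borel_measurable X" "\<And>m. integrable (F m) (\<lambda>x. (W x)\<^sup>2)" "\<And>x. 0 \<le> W x"
    "\<forall>\<^sub>F N in sequentially. \<forall>j\<in>{1..N}. \<forall>x. \<bar>summand c N j x\<bar> \<le> W x / sqrt (real N)"
proof -
  obtain B where B: "0 \<le> B" "\<forall>\<^sub>F N in sequentially. \<forall>m. \<forall>j\<in>{1..N}. \<bar>weight p N m j\<bar> \<le> B"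
    using weight_bounded[OF p \<Gamma>] by blast
  define \<kappa> where "\<kappa> i = (\<Sum>m\<in>UNIV. \<bar>M1 m $ i\<bar>)" for i
  \<comment> \<open>\<open>B\<close> bounds the weights and \<open>\<kappa> i\<close> the centering
    terms (\<open>mean_le\<close>); square integrability reduces to the integrable products of
    coordinates of \<open>g\<close>.\<close>
  define W where "W x = (\<Sum>i\<in>UNIV. \<bar>c $ i\<bar> * B * (\<bar>g x $ i\<bar> + \<kappa> i))" for x
  have \<kappa>0: "0 \<le> \<kappa> i" for i
    unfolding \<kappa>_def by (intro sum_nonneg) auto
  have 1: "W \<in> borel_measurable X"
    unfolding W_def using g_nth by measurable
  have prod: "integrable (F m) (\<lambda>x. (\<bar>g x $ i\<bar> + \<kappa> i) * (\<bar>g x $ i'\<bar> + \<kappa> i'))" for m i i'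
  proof -
    have "(\<lambda>x. (\<bar>g x $ i\<bar> + \<kappa> i) * (\<bar>g x $ i'\<bar> + \<kappa> i'))
      = (\<lambda>x. \<bar>g x $ i * g x $ i'\<bar> + \<kappa> i' * \<bar>g x $ i\<bar> + \<kappa> i * \<bar>g x $ i'\<bar> + \<kappa> i * \<kappa> i')"
      by (auto simp: algebra_simps abs_mult)
    then show ?thesis
      by (simp only:) (intro Bochner_Integration.integrable_add integrable_mult_right integrable_abs
          moments integrable_F_const)
  qed
  have W2: "(W x)\<^sup>2 = (\<Sum>i\<in>UNIV. \<Sum>i'\<in>UNIV. (\<bar>c $ i\<bar> * B * (\<bar>c $ i'\<bar> * B))
      * ((\<bar>g x $ i\<bar> + \<kappa> i) * (\<bar>g x $ i'\<bar> + \<kappa> i')))" for x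
    unfolding W_def power2_eq_square sum_product by (simp only: ac_simps)
  have 2: "integrable (F m) (\<lambda>x. (W x)\<^sup>2)" for m
    unfolding W2 by (intro Bochner_Integration.integrable_sum integrable_mult_right prod)
  have 3: "0 \<le> W x" for x
    unfolding W_def using B(1) \<kappa>0 by (intro sum_nonneg mult_nonneg_nonneg add_nonneg_nonneg) auto
  have 4: "\<forall>\<^sub>F N in sequentially. \<forall>j\<in>{1..N}. \<forall>x. \<bar>summand c N j x\<bar> \<le> W x / sqrt (real N)"
    using B(2) eventually_ge_at_top[of 1]
  proof eventually_elim
    case (elim N)
    show ?case
    proof (intro ballI allI)
      fix j x
      assume j: "j \<in> {1..N}"
      have "\<bar>\<Sum>i\<in>UNIV. c $ i * weight p N (\<iota> (blk i)) j * (g x $ i - mean N j i)\<bar>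
          \<le> (\<Sum>i\<in>UNIV. \<bar>c $ i * weight p N (\<iota> (blk i)) j * (g x $ i - mean N j i)\<bar>)"
        by (rule sum_abs)
      also have "\<dots> \<le> W x"
        unfolding W_def abs_mult
      proof (intro sum_mono mult_mono)
        fix i
        show "\<bar>weight p N (\<iota> (blk i)) j\<bar> \<le> B"
          using elim j by blast
        show "\<bar>g x $ i - mean N j i\<bar> \<le> \<bar>g x $ i\<bar> + \<kappa> i"
          using mean_le[OF elim(2) j, of i] unfolding \<kappa>_def by linarith
      qed (use B(1) in auto)
      finally show "\<bar>summand c N j x\<bar> \<le> W x / sqrt (real N)"
        by (simp add: summand_def divide_right_mono)
    qed
  qed
  show ?thesis
    using that 1 2 3 4 by blast
qed

text \<open>With summands at most \<open>W / sqrt N\<close>, the first sum is bounded by integrals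
  of \<open>?h N\<close>, which vanish by dominated convergence. Each variance is at most
  \<open>V / N\<close>, so the second sum is at most \<open>V^2 / N\<close>.\<close>

lemma lindeberg_remainder_tendsto_0:
  assumes \<Gamma>: "(\<lambda>N. Gamma_mat p N) \<longlonglongrightarrow> \<Gamma>" "invertible \<Gamma>"
  shows "(\<lambda>N. (\<Sum>j=1..N. expectation (\<lambda>\<omega>. min (6 * (summand c N j (\<xi> N j \<omega>))\<^sup>2) (\<bar>summand c N j (\<xi> N j \<omega>)\<bar> ^ 3)))
    + (\<Sum>j=1..N. (expectation (\<lambda>\<omega>. (summand c N j (\<xi> N j \<omega>))\<^sup>2))\<^sup>2)) \<longlonglongrightarrow> 0"
proof -
  obtain W where W: "W \<in> borel_measurable X" "\<And>m. integrable (F m) (\<lambda>x. (W x)\<^sup>2)" "\<And>x. 0 \<le> W x"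
    and dom: "\<forall>\<^sub>F N in sequentially. \<forall>j\<in>{1..N}. \<forall>x. \<bar>summand c N j x\<bar> \<le> W x / sqrt (real N)"
    using summand_dominated[OF \<Gamma>] by blast
  define V where "V = (\<Sum>m\<in>UNIV. LINT x|F m. (W x)\<^sup>2)"
  \<comment> \<open>This is \<open>N\<close> times the bound on a single remainder term, which is
    why the \<open>N\<close> equal bounds \<open>L N / real N\<close> below add up to
    \<open>L N\<close>.\<close>
  let ?h = "\<lambda>N x. min (6 * (W x)\<^sup>2) (W x ^ 3 / sqrt (real N))"
  define L where "L N = (\<Sum>m\<in>UNIV. LINT x|F m. ?h N x)" for N
  have F_meas: "f \<in> borel_measurable X \<Longrightarrow> f \<in> borel_measurable (F m)" for f :: "'x \<Rightarrow> real" and m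
    using measurable_cong_sets[OF F(2)[of m] refl] by blast
  have h_meas: "(\<lambda>x. ?h N x) \<in> borel_measurable X" for N
    using W(1) by measurable
  have h0: "0 \<le> ?h N x" for N x
    using W(3)[of x] by simp
  have h_int: "integrable (F m) (\<lambda>x. ?h N x)" for m N
    by (rule Bochner_Integration.integrable_bound[OF integrable_mult_right[OF W(2), where c = 6]])
      (use F_meas[OF h_meas] in \<open>auto simp: abs_of_nonneg[OF h0] intro!: AE_I2\<close>)
  have "(\<lambda>N. LINT x|F m. ?h N x) \<longlonglongrightarrow> (LINT x|F m. 0)" for m
  proof (rule integral_dominated_convergence[where w = "\<lambda>x. 6 * (W x)\<^sup>2"])
    show "AE x in F m. (\<lambda>N. ?h N x) \<longlonglongrightarrow> 0"
    proof (intro AE_I2)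
      fix x
      have "(\<lambda>N. W x ^ 3 / sqrt (real N)) \<longlonglongrightarrow> 0"
        by (intro tendsto_divide_0[OF tendsto_const] filterlim_at_top_imp_at_infinity
            filterlim_compose[OF sqrt_at_top] filterlim_real_sequentially)
      from tendsto_min[OF tendsto_const[of "6 * (W x)\<^sup>2"] this] show "(\<lambda>N. ?h N x) \<longlonglongrightarrow> 0"
        by simp
    qed
  qed (use W(2) F_meas[OF h_meas] in \<open>auto simp: abs_of_nonneg[OF h0] intro!: AE_I2\<close>)
  then have L: "L \<longlonglongrightarrow> 0"
    unfolding L_def by (intro tendsto_null_sum) simp
  have V: "(\<lambda>N. V\<^sup>2 / real N) \<longlonglongrightarrow> 0"
    by (rule lim_const_over_n)
  show ?thesis
  proof (rule Lim_null_comparison)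
    show "(\<lambda>N. L N + V\<^sup>2 / real N) \<longlonglongrightarrow> 0"
      using tendsto_add[OF L V] by simp
    show "\<forall>\<^sub>F N in sequentially. norm ((\<Sum>j=1..N. expectation (\<lambda>\<omega>. min (6 * (summand c N j (\<xi> N j \<omega>))\<^sup>2) (\<bar>summand c N j (\<xi> N j \<omega>)\<bar> ^ 3)))
      + (\<Sum>j=1..N. (expectation (\<lambda>\<omega>. (summand c N j (\<xi> N j \<omega>))\<^sup>2))\<^sup>2)) \<le> L N + V\<^sup>2 / real N"
      using dom eventually_ge_at_top[of 1]
    proof eventually_elim
      case (elim N)
      then have N0: "0 < real N" by simp
      let ?Y = "\<lambda>j \<omega>. summand c N j (\<xi> N j \<omega>)"
      have sq_le: "(summand c N j x)\<^sup>2 \<le> (W x)\<^sup>2 / real N" if j: "j \<in> {1..N}" for j x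
        using power_mono[OF bspec[OF elim(1) j, rule_format, of x], of 2] N0 by (simp add: power_divide)
      have cube_le: "\<bar>summand c N j x\<bar> ^ 3 \<le> W x ^ 3 / sqrt (real N) / real N" if j: "j \<in> {1..N}" for j x
        using power_mono[OF bspec[OF elim(1) j, rule_format, of x], of 3] N0
        by (simp add: power_divide power3_eq_cube mult.commute[of "real N"])
      have sq: "expectation (\<lambda>\<omega>. (?Y j \<omega>)\<^sup>2) \<le> V / real N" if j: "j \<in> {1..N}" for j
      proof -
        have "expectation (\<lambda>\<omega>. (?Y j \<omega>)\<^sup>2) \<le> expectation (\<lambda>\<omega>. (W (\<xi> N j \<omega>))\<^sup>2 / real N)"
          using W(1) by (intro integral_mono integrable_summand_sq elim(2) j sq_le
              expectation_mixture(1)[OF elim(2) j, of "\<lambda>x. (W x)\<^sup>2 / real N"] integrable_divide_zero W(2)) auto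
        also have "\<dots> \<le> (\<Sum>m\<in>UNIV. LINT x|F m. (W x)\<^sup>2 / real N)"
          using W by (intro expectation_le_sum[OF elim(2) j]) auto
        finally show ?thesis
          by (simp add: V_def sum_divide_distrib)
      qed
      have mn: "expectation (\<lambda>\<omega>. min (6 * (?Y j \<omega>)\<^sup>2) (\<bar>?Y j \<omega>\<bar> ^ 3)) \<le> L N / real N" if j: "j \<in> {1..N}" for j
      proof -
        have meas: "(\<lambda>\<omega>. ?Y j \<omega>) \<in> borel_measurable P"
          using elim(2) j by (intro measurable_compose[OF \<xi>_measurable summand_measurable])
        have "expectation (\<lambda>\<omega>. min (6 * (?Y j \<omega>)\<^sup>2) (\<bar>?Y j \<omega>\<bar> ^ 3)) \<le> expectation (\<lambda>\<omega>. ?h N (\<xi> N j \<omega>) / real N)"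
        proof (intro integral_mono)
          show "integrable P (\<lambda>\<omega>. min (6 * (?Y j \<omega>)\<^sup>2) (\<bar>?Y j \<omega>\<bar> ^ 3))"
            by (rule Bochner_Integration.integrable_bound[OF integrable_mult_right[OF integrable_summand_sq[OF elim(2) j, of c], where c = 6]])
              (use meas in \<open>auto simp: abs_of_nonneg[of "min _ _"] intro!: AE_I2\<close>)
          show "integrable P (\<lambda>\<omega>. ?h N (\<xi> N j \<omega>) / real N)"
            by (rule expectation_mixture(1)[OF elim(2) j, of "\<lambda>x. ?h N x / real N"])
              (use h_meas h_int in auto)
          show "min (6 * (?Y j \<omega>)\<^sup>2) (\<bar>?Y j \<omega>\<bar> ^ 3) \<le> ?h N (\<xi> N j \<omega>) / real N" for \<omega>
            using sq_le[OF j, of "\<xi> N j \<omega>"] cube_le[OF j, of "\<xi> N j \<omega>"] N0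
            by (simp add: min_divide_distrib_right) (auto simp: min_le_iff_disj)
        qed
        also have "\<dots> \<le> (\<Sum>m\<in>UNIV. LINT x|F m. ?h N x / real N)"
          using W(3) h_meas h_int by (intro expectation_le_sum[OF elim(2) j]) auto
        finally show ?thesis
          by (simp add: L_def sum_divide_distrib)
      qed
      have "(\<Sum>j=1..N. expectation (\<lambda>\<omega>. min (6 * (?Y j \<omega>)\<^sup>2) (\<bar>?Y j \<omega>\<bar> ^ 3))) \<le> (\<Sum>j=1..N. L N / real N)"
        by (intro sum_mono mn)
      moreover have "(\<Sum>j=1..N. (expectation (\<lambda>\<omega>. (?Y j \<omega>)\<^sup>2))\<^sup>2) \<le> (\<Sum>j=1..N. (V / real N)\<^sup>2)"
        by (intro sum_mono power_mono sq) auto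
      moreover have "(\<Sum>j=1..N. L N / real N) = L N" "(\<Sum>j=1..N. (V / real N)\<^sup>2) = V\<^sup>2 / real N"
        using N0 by (simp_all add: power2_eq_square)
      moreover have "0 \<le> (\<Sum>j=1..N. expectation (\<lambda>\<omega>. min (6 * (?Y j \<omega>)\<^sup>2) (\<bar>?Y j \<omega>\<bar> ^ 3)))"
          "0 \<le> (\<Sum>j=1..N. (expectation (\<lambda>\<omega>. (?Y j \<omega>)\<^sup>2))\<^sup>2)"
        by (auto intro!: sum_nonneg integral_nonneg)
      ultimately show ?case
        unfolding real_norm_def by linarith
    qed
  qed
qed

text \<open>The comparison is with the Gaussian of the exact variance, and only then does the
  variance tend to its limit. Nothing is divided by a standard deviation, so directions
  \<open>c\<close> with degenerate limit are covered.\<close>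

lemma char_err_tendsto:
  assumes \<Gamma>: "(\<lambda>N. Gamma_mat p N) \<longlonglongrightarrow> \<Gamma>" "invertible \<Gamma>" and \<Sigma>: "S \<longlonglongrightarrow> \<Sigma>"
  shows "(\<lambda>N. char (distr P borel (\<lambda>\<omega>. c \<bullet> err N \<omega>)) 1) \<longlonglongrightarrow> exp (- (c \<bullet> (\<Sigma> *v c)) / 2)"
proof -
  let ?\<phi> = "\<lambda>N. char (distr P borel (\<lambda>\<omega>. c \<bullet> err N \<omega>)) 1"
  have "(\<lambda>N. ?\<phi> N - exp (- (c \<bullet> (S N *v c)) / 2)) \<longlonglongrightarrow> 0"
  proof (rule Lim_null_comparison[OF _ lindeberg_remainder_tendsto_0[OF \<Gamma>, of c]])
    show "\<forall>\<^sub>F N in sequentially. norm (?\<phi> N - exp (- (c \<bullet> (S N *v c)) / 2))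
      \<le> (\<Sum>j=1..N. expectation (\<lambda>\<omega>. min (6 * (summand c N j (\<xi> N j \<omega>))\<^sup>2) (\<bar>summand c N j (\<xi> N j \<omega>)\<bar> ^ 3)))
        + (\<Sum>j=1..N. (expectation (\<lambda>\<omega>. (summand c N j (\<xi> N j \<omega>))\<^sup>2))\<^sup>2)"
      using tendsto_matrix_inv(1)[OF \<Gamma>] eventually_ge_at_top[of 1]
    proof eventually_elim
      case (elim N)
      show ?case
        unfolding err_eq_sum[OF elim(2,1)] sum_variance_summand[OF elim(2), symmetric]
        by (intro char_indep_sum_approx indep_summand elim(2) integrable_summand_sq expectation_summand) auto
    qed
  qed
  moreover have "(\<lambda>N. complex_of_real (exp (- (c \<bullet> (S N *v c)) / 2))) \<longlonglongrightarrow> complex_of_real (exp (- (c \<bullet> (\<Sigma> *v c)) / 2))"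
    unfolding quadratic_form_sum by (intro tendsto_intros \<Sigma>) auto
  ultimately show ?thesis
    by (rule Lim_transform[rotated])
qed

lemma \<Sigma>_psd:
  assumes \<Gamma>: "(\<lambda>N. Gamma_mat p N) \<longlonglongrightarrow> \<Gamma>" "invertible \<Gamma>" and \<Sigma>: "S \<longlonglongrightarrow> \<Sigma>"
  shows "0 \<le> c \<bullet> (\<Sigma> *v c)"
proof (rule tendsto_lowerbound)
  show "(\<lambda>N. c \<bullet> (S N *v c)) \<longlonglongrightarrow> c \<bullet> (\<Sigma> *v c)"
    unfolding quadratic_form_sum by (intro tendsto_intros \<Sigma>)
  show "\<forall>\<^sub>F N in sequentially. 0 \<le> c \<bullet> (S N *v c)"
    using eventually_ge_at_top[of 1]
    by eventually_elim (simp add: sum_variance_summand[symmetric] sum_nonneg)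
qed simp

lemma \<Sigma>_symmetric:
  assumes \<Sigma>: "S \<longlonglongrightarrow> \<Sigma>"
  shows "transpose \<Sigma> = \<Sigma>"
proof -
  have "transpose (S N) = S N" for N
  proof -
    have "S N $ i $ j = S N $ j $ i" for i j
    proof -
      \<comment> \<open>Exchanging \<open>i\<close> and \<open>j\<close> also exchanges the roles of
        \<open>r\<close> and \<open>s\<close>, so the order of summation has to be swapped to
        match.\<close>
      have "(\<Sum>r\<in>UNIV. \<Sum>s\<in>UNIV. alpha_coef \<iota> p N r s (blk i) (blk j) * (M1 r $ i * M1 s $ j))
          = (\<Sum>s\<in>UNIV. \<Sum>r\<in>UNIV. alpha_coef \<iota> p N r s (blk i) (blk j) * (M1 r $ i * M1 s $ j))"
        by (rule sum.swap)
      then show ?thesis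
        by (simp add: S_def Sigma_mat_def alpha_coef_def beta_coef_def moment2_def ac_simps)
    qed
    then show ?thesis
      by (simp add: vec_eq_iff transpose_def)
  qed
  with tendsto_transpose[OF \<Sigma>] have "S \<longlonglongrightarrow> transpose \<Sigma>"
    by simp
  then show ?thesis
    using LIMSEQ_unique \<Sigma> by blast
qed

text \<open>Chebyshev's bound: the expected squared norm of the error is the trace of
  \<open>S N\<close>, which converges.\<close>

lemma err_tight:
  assumes \<Gamma>: "(\<lambda>N. Gamma_mat p N) \<longlonglongrightarrow> \<Gamma>" "invertible \<Gamma>" and \<Sigma>: "S \<longlonglongrightarrow> \<Sigma>" and e: "0 < e"
  obtains K where "\<forall>\<^sub>F N in sequentially. prob {\<omega> \<in> space P. K < norm (err N \<omega>)} \<le> e"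
proof -
  define \<tau> where "\<tau> = (\<Sum>i\<in>UNIV. \<Sigma> $ i $ i)"
  have "(\<lambda>N. \<Sum>i\<in>UNIV. S N $ i $ i) \<longlonglongrightarrow> \<tau>"
    unfolding \<tau>_def by (intro tendsto_intros \<Sigma>)
  then have ev: "\<forall>\<^sub>F N in sequentially. (\<Sum>i\<in>UNIV. S N $ i $ i) < \<bar>\<tau>\<bar> + 1"
    by (rule order_tendstoD(2)) simp
  \<comment> \<open>Chosen so that the eventual trace bound divided by the square of
    \<open>K\<close> is exactly \<open>e\<close>; \<open>\<bar>\<tau>\<bar> + 1\<close> is positive
    and exceeds the limit of the traces.\<close>
  define K where "K = sqrt ((\<bar>\<tau>\<bar> + 1) / e)"
  have K0: "0 \<le> K"
    using e by (simp add: K_def)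
  have K2: "K\<^sup>2 = (\<bar>\<tau>\<bar> + 1) / e" and Kpos: "0 < K\<^sup>2"
    using e by (auto simp: K_def divide_simps)
  have "\<forall>\<^sub>F N in sequentially. prob {\<omega> \<in> space P. K < norm (err N \<omega>)} \<le> e"
    using ev tendsto_matrix_inv(1)[OF \<Gamma>] eventually_ge_at_top[of 1]
  proof eventually_elim
    case (elim N)
    note [measurable] = err_measurable[of N]
    have comp: "integrable P (\<lambda>\<omega>. (err N \<omega> $ i)\<^sup>2)" "expectation (\<lambda>\<omega>. (err N \<omega> $ i)\<^sup>2) = S N $ i $ i" for i
      using second_moment_err[OF elim(3,2), of "axis i 1"]
      by (simp_all add: inner_axis' matrix_vector_mult_basis column_def)
    have n2: "(norm (err N \<omega>))\<^sup>2 = (\<Sum>i\<in>UNIV. (err N \<omega> $ i)\<^sup>2)" for \<omega>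
      by (simp add: norm_vec_def L2_set_def sum_nonneg)
    have "prob {\<omega> \<in> space P. K < norm (err N \<omega>)} \<le> prob {\<omega> \<in> space P. K\<^sup>2 \<le> (norm (err N \<omega>))\<^sup>2}"
      using Kpos e by (intro finite_measure_mono) (auto intro!: power_mono K0)
    also have "\<dots> \<le> expectation (\<lambda>\<omega>. (norm (err N \<omega>))\<^sup>2) / K\<^sup>2"
      by (rule integral_Markov_inequality_measure[OF _ sets.empty_sets _ Kpos])
        (auto simp: n2 comp(1) intro!: Bochner_Integration.integrable_sum sum_nonneg)
    also have "expectation (\<lambda>\<omega>. (norm (err N \<omega>))\<^sup>2) = (\<Sum>i\<in>UNIV. S N $ i $ i)"
      unfolding n2 by (simp add: comp)
    also have "\<dots> / K\<^sup>2 \<le> (\<bar>\<tau>\<bar> + 1) / K\<^sup>2"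
      using elim(1) Kpos by (intro divide_right_mono) auto
    also have "\<dots> = e"
      using e by (simp add: K2 divide_simps)
    finally show ?case .
  qed
  with that show ?thesis by blast
qed

end

text \<open>A sandwich form of Slutsky's lemma for events: off the small set \<open>B\<close>, the
  event \<open>A n\<close> lies between the upper level sets of \<open>Y n\<close> at
  \<open>q + \<epsilon>\<close> and \<open>q - \<epsilon>\<close>, and continuity of
  \<open>G\<close> makes their limiting probabilities close. No statistic defining
  \<open>A n\<close> is mentioned.\<close>

lemma (in prob_space) tendsto_prob_of_approximation:
  fixes Y :: "nat \<Rightarrow> 'a \<Rightarrow> real"
  assumes Y[measurable]: "\<And>n. Y n \<in> borel_measurable M"
    and lim: "\<And>y. (\<lambda>n. prob {\<omega> \<in> space M. y \<le> Y n \<omega>}) \<longlonglongrightarrow> G y" and G: "isCont G q"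
    and A: "\<forall>\<^sub>F n in sequentially. A n \<in> events"
    and approx: "\<And>\<epsilon> e. 0 < \<epsilon> \<Longrightarrow> 0 < e \<Longrightarrow> \<forall>\<^sub>F n in sequentially. \<exists>B\<in>events. prob B \<le> e \<and>
      (\<forall>\<omega>\<in>space M - B. (\<omega> \<in> A n \<longrightarrow> q - \<epsilon> \<le> Y n \<omega>) \<and> (q + \<epsilon> \<le> Y n \<omega> \<longrightarrow> \<omega> \<in> A n))"
  shows "(\<lambda>n. prob (A n)) \<longlonglongrightarrow> G q"
proof (rule tendstoI)
  fix e :: real
  assume "0 < e"
  then have e: "0 < e / 3" by simp
  obtain d where d: "0 < d" "\<And>y. \<bar>y - q\<bar> < d \<Longrightarrow> \<bar>G y - G q\<bar> < e / 3"
    using G e unfolding continuous_at_eps_delta dist_real_def by blast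
  define \<epsilon> where "\<epsilon> = d / 2"
  have \<epsilon>: "0 < \<epsilon>" "\<bar>G (q - \<epsilon>) - G q\<bar> < e / 3" "\<bar>G (q + \<epsilon>) - G q\<bar> < e / 3"
    using d by (auto simp: \<epsilon>_def)
  show "\<forall>\<^sub>F n in sequentially. dist (prob (A n)) (G q) < e"
    using A approx[OF \<epsilon>(1) e] tendstoD[OF lim[of "q - \<epsilon>"] e] tendstoD[OF lim[of "q + \<epsilon>"] e]
  proof eventually_elim
    case (elim n)
    then obtain B where B: "B \<in> events" "prob B \<le> e / 3"
      and AB: "\<And>\<omega>. \<omega> \<in> space M - B \<Longrightarrow> (\<omega> \<in> A n \<longrightarrow> q - \<epsilon> \<le> Y n \<omega>) \<and> (q + \<epsilon> \<le> Y n \<omega> \<longrightarrow> \<omega> \<in> A n)"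
      by blast
    note [measurable] = elim(1) B(1)
    have "prob (A n) \<le> prob ({\<omega> \<in> space M. q - \<epsilon> \<le> Y n \<omega>} \<union> B)"
      using AB sets.sets_into_space[OF elim(1)] by (intro finite_measure_mono) auto
    also have "\<dots> \<le> prob {\<omega> \<in> space M. q - \<epsilon> \<le> Y n \<omega>} + prob B"
      by (intro measure_Un_le) auto
    finally have upper: "prob (A n) \<le> prob {\<omega> \<in> space M. q - \<epsilon> \<le> Y n \<omega>} + prob B" .
    have "prob {\<omega> \<in> space M. q + \<epsilon> \<le> Y n \<omega>} \<le> prob (A n \<union> B)"
      using AB by (intro finite_measure_mono) auto
    also have "\<dots> \<le> prob (A n) + prob B"
      by (intro measure_Un_le) auto
    finally have lower: "prob {\<omega> \<in> space M. q + \<epsilon> \<le> Y n \<omega>} \<le> prob (A n) + prob B" .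
    show ?case
      using upper lower B(2) elim(3,4) \<epsilon>(2,3) unfolding dist_real_def by linarith
  qed
qed

section \<open>Asymptotic level of the test\<close>

lemma dot_matrix_vector:
  fixes A :: "real ^ 'n ^ 'm"
  shows "(A *v x) \<bullet> y = x \<bullet> (transpose A *v y)"
  by (metis dot_lmul_matrix inner_commute transpose_matrix_vector)

lemma continuous_on_block_vec: "continuous_on S (block_vec blk k)"
proof -
  have "continuous_on S (\<lambda>v. if blk i = k then v $ i else 0)" for i
    by (cases "blk i = k") (auto intro!: continuous_intros)
  then show ?thesis
    unfolding block_vec_def by (rule continuous_on_vec_lambda)
qed

lemma continuous_on_block_mat: "continuous_on S (block_mat blk k l)"
proof -
  have "continuous_on S (\<lambda>A. if blk i = k \<and> blk j = l then A $ i $ j else 0)" for i j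
    by (cases "blk i = k \<and> blk j = l") (auto intro!: continuous_intros simp del: split_paired_All)
  then show ?thesis
    unfolding block_mat_def by (intro continuous_on_vec_lambda)
qed

theorem theorem5:
  fixes P :: "'w measure"
    and X :: "'x measure"
    and F :: "'m::finite \<Rightarrow> 'x measure"
    and p :: "nat \<Rightarrow> 'm \<Rightarrow> nat \<Rightarrow> real"
    and \<xi> :: "nat \<Rightarrow> nat \<Rightarrow> 'w \<Rightarrow> 'x"
    and \<iota> :: "'k::finite \<Rightarrow> 'm"
    and blk :: "'d::finite \<Rightarrow> 'k"
    and g :: "'x \<Rightarrow> real ^ 'd"
    and T :: "real ^ 'd \<Rightarrow> real ^ 'l::finite"
    and \<Gamma> :: "real ^ 'm ^ 'm"
    and a :: "'m \<Rightarrow> 'm \<Rightarrow> 'k \<Rightarrow> 'k \<Rightarrow> real"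
    and b :: "'m \<Rightarrow> 'k \<Rightarrow> 'k \<Rightarrow> real"
    and e1 :: "nat \<Rightarrow> 'm \<Rightarrow> (nat \<Rightarrow> 'x) \<Rightarrow> real ^ 'd"
    and e2 :: "nat \<Rightarrow> 'm \<Rightarrow> (nat \<Rightarrow> 'x) \<Rightarrow> real ^ 'd ^ 'd"
    and R :: "nat \<Rightarrow> (nat \<Rightarrow> 'x) set"
    and \<alpha> :: real
  defines "gbar \<equiv> diag_stack \<iota> blk (\<lambda>m. moment1 (F m) g)"
    and "\<Sigma> \<equiv> Sigma_mat blk b a (\<lambda>m. moment2 (F m) g) (\<lambda>m. moment1 (F m) g)"
  assumes P: "prob_space P"
    and F: "\<And>m. prob_space (F m)" "\<And>m. sets (F m) = sets X"
    and p: "\<And>N m j. N \<ge> 1 \<Longrightarrow> j \<in> {1..N} \<Longrightarrow> p N m j \<ge> 0"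
      "\<And>N j. N \<ge> 1 \<Longrightarrow> j \<in> {1..N} \<Longrightarrow> (\<Sum>m\<in>UNIV. p N m j) = 1"
    and \<xi>_indep: "\<And>N. N \<ge> 1 \<Longrightarrow> prob_space.indep_vars P (\<lambda>_. X) (\<xi> N) {1..N}"
    and \<xi>_law: "\<And>N j A. N \<ge> 1 \<Longrightarrow> j \<in> {1..N} \<Longrightarrow> A \<in> sets X \<Longrightarrow>
      measure P {\<omega> \<in> space P. \<xi> N j \<omega> \<in> A} = (\<Sum>m\<in>UNIV. p N m j * measure (F m) A)"
    and \<iota>: "inj \<iota>" and blk: "surj blk"
    and g: "g \<in> borel_measurable X"
    and T: "T \<in> borel_measurable borel"
    and e1: "\<And>N m. N \<ge> 1 \<Longrightarrow> e1 N m \<in> borel_measurable (PiM {1..N} (\<lambda>_. X))"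
    and e2: "\<And>N m. N \<ge> 1 \<Longrightarrow> e2 N m \<in> borel_measurable (PiM {1..N} (\<lambda>_. X))"
    and \<alpha>: "0 < \<alpha>" "\<alpha> < 1"
    and test: "\<And>N. N \<ge> 1 \<Longrightarrow> is_rejection_region X \<iota> blk p g T e1 e2 N \<alpha> (R N)"
    and T_diff: "T differentiable (at gbar)"
    and moments: "\<And>m i. integrable (F m) (\<lambda>x. g x $ i)"
      "\<And>m i j. integrable (F m) (\<lambda>x. g x $ i * g x $ j)"
    and moments_delta: "\<exists>\<delta>>0. \<forall>k m.
      integrable (F m) (\<lambda>x. norm (block_vec blk k (g x)) powr (2 + \<delta>))"
    and \<Gamma>: "(\<lambda>N. Gamma_mat p N) \<longlonglongrightarrow> \<Gamma>" "invertible \<Gamma>"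
    and a: "\<And>r s k l. (\<lambda>N. alpha_coef \<iota> p N r s k l) \<longlonglongrightarrow> a r s k l"
    and b: "\<And>m k l. (\<lambda>N. beta_coef \<iota> p N m k l) \<longlonglongrightarrow> b m k l"
    and D: "invertible (D_mat T gbar \<Sigma>)"
    and consistent:
      "tendsto_in_prob P (\<lambda>N \<omega>. diag_stack \<iota> blk (\<lambda>m. e1 N m (sample \<xi> N \<omega>))) gbar"
      "\<And>k m. tendsto_in_prob P (\<lambda>N \<omega>. block_vec blk k (e1 N m (sample \<xi> N \<omega>)))
         (block_vec blk k (moment1 (F m) g))"
      "\<And>k l m. tendsto_in_prob P (\<lambda>N \<omega>. block_mat blk k l (e2 N m (sample \<xi> N \<omega>)))
         (block_mat blk k l (moment2 (F m) g))"
    and T'_cont: "\<exists>U. open U \<and> gbar \<in> U \<and> (\<forall>y\<in>U. T differentiable (at y)) \<and>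
      continuous_on U (\<lambda>y. jacobian T (at y))"
    and H0: "T gbar = 0"
  shows "(\<lambda>N. measure P {\<omega> \<in> space P. sample \<xi> N \<omega> \<in> R N}) \<longlonglongrightarrow> \<alpha>"
proof -
  interpret prob_space P by (rule P)
  interpret mix: mixture_sample P X F p \<xi> \<iota> blk g
    by (intro mixture_sample.intro mixture_sample_axioms.intro P F p \<xi>_indep \<xi>_law g moments)
  interpret C: real_distribution "chi_square CARD('l)"
    by (rule real_distribution_chi_square)
  have moment_vec: "mix.moment_vec = gbar"
    by (simp add: mix.moment_vec_def gbar_def)
  have S: "mix.S \<longlonglongrightarrow> \<Sigma>"
    unfolding mix.S_def[abs_def] \<Sigma>_def Sigma_mat_def by (intro tendsto_vec_lambda tendsto_intros a b)
  define A where "A = jacobian T (at gbar)"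
  define Dm where "Dm = D_mat T gbar \<Sigma>"
  have Dm: "Dm = A ** \<Sigma> ** transpose A"
    by (simp add: Dm_def D_mat_def A_def)
  have inv: "invertible Dm"
    using D by (simp add: Dm_def)
  have sym: "transpose Dm = Dm"
    by (simp add: Dm matrix_transpose_mul mix.\<Sigma>_symmetric[OF S] matrix_mul_assoc)
  have "0 \<le> x \<bullet> (Dm *v x)" for x
  proof -
    have "x \<bullet> (Dm *v x) = (transpose A *v x) \<bullet> (\<Sigma> *v (transpose A *v x))"
      by (simp only: Dm dot_matrix_vector transpose_transpose matrix_vector_mul_assoc matrix_mul_assoc)
    then show ?thesis
      using mix.\<Sigma>_psd[OF \<Gamma> S] by simp
  qed
  then have pd: "x \<noteq> 0 \<Longrightarrow> 0 < x \<bullet> (Dm *v x)" for x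
    by (rule pos_def_of_psd_invertible[OF sym _ inv])
  \<comment> \<open>\<open>C\<close> whitens: the first identity makes the limiting covariance of
    \<open>Z\<close> the identity matrix, the second turns the squared norm of \<open>Z\<close> into
    the quadratic form of the test statistic.\<close>
  obtain C :: "real ^ 'l ^ 'l" where C: "transpose C ** Dm ** C = mat 1" "matrix_inv Dm = C ** transpose C"
    by (rule pos_def_inverse_factor[OF sym pd])
  define Z where "Z N \<omega> = transpose C *v (A *v mix.err N \<omega>)" for N \<omega>
  have Z_meas[measurable]: "Z N \<in> borel_measurable P" for N
    unfolding Z_def
    by (intro measurable_compose[OF mix.err_measurable] borel_measurable_continuous_onI
        continuous_on_compose2[OF matrix_vector_mult_linear_continuous_on] matrix_vector_mult_linear_continuous_on) auto
  have Z_sq: "(norm (Z N \<omega>))\<^sup>2 = (A *v mix.err N \<omega>) \<bullet> (matrix_inv Dm *v (A *v mix.err N \<omega>))" for N \<omega>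
    unfolding Z_def C(2) power2_norm_eq_inner
    by (simp only: dot_matrix_vector matrix_transpose_mul transpose_transpose matrix_vector_mul_assoc matrix_mul_assoc)
  have char: "(\<lambda>N. char (distr P borel (\<lambda>\<omega>. t \<bullet> Z N \<omega>)) 1) \<longlonglongrightarrow> exp (- (norm t)\<^sup>2 / 2)" for t
  proof -
    \<comment> \<open>Moving \<open>C\<close> and \<open>A\<close> across the inner product turns a
      projection of \<open>Z\<close> into a projection of the error, to which the one-dimensional
      limit applies.\<close>
    define c where "c = transpose A *v (C *v t)"
    have "t \<bullet> Z N \<omega> = c \<bullet> mix.err N \<omega>" for N \<omega>
      by (simp only: c_def Z_def dot_matrix_vector transpose_transpose)
    moreover have "c \<bullet> (\<Sigma> *v c) = (norm t)\<^sup>2"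
    proof -
      have "c \<bullet> (\<Sigma> *v c) = (C *v t) \<bullet> (Dm *v (C *v t))"
        by (simp only: c_def Dm dot_matrix_vector matrix_transpose_mul transpose_transpose matrix_vector_mul_assoc matrix_mul_assoc)
      also have "\<dots> = t \<bullet> ((transpose C ** Dm ** C) *v t)"
        by (simp only: dot_matrix_vector matrix_vector_mul_assoc matrix_mul_assoc)
      finally show ?thesis
        by (simp add: C(1) power2_norm_eq_inner)
    qed
    ultimately show ?thesis
      using mix.char_err_tendsto[OF \<Gamma> S, of c] by simp
  qed
  have atomless: "C.prob {y} = 0" for y
    by (rule chi_square_singleton) simp
  define q where "q = quantile (chi_square CARD('l)) (1 - \<alpha>)"
  have "1 - cdf (chi_square CARD('l)) q = \<alpha>"
    using C.cdf_quantile[OF atomless, of "1 - \<alpha>"] \<alpha> by (simp add: q_def)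
  moreover have "(\<lambda>N. prob {\<omega> \<in> space P. sample \<xi> N \<omega> \<in> R N}) \<longlonglongrightarrow> 1 - cdf (chi_square CARD('l)) q"
  proof (rule tendsto_prob_of_approximation[where Y = "\<lambda>N \<omega>. (norm (Z N \<omega>))\<^sup>2"
        and G = "\<lambda>y. 1 - cdf (chi_square CARD('l)) y" and q = q and A = "\<lambda>N. {\<omega> \<in> space P. sample \<xi> N \<omega> \<in> R N}"])
    have sample_meas: "sample \<xi> N \<in> measurable P (PiM {1..N} (\<lambda>_. X))" if "N \<ge> 1" for N
      unfolding sample_def using mix.\<xi>_measurable[OF that] by (intro measurable_restrict) auto
    show "(\<lambda>\<omega>. (norm (Z N \<omega>))\<^sup>2) \<in> borel_measurable P" for N
      by measurable
    show "(\<lambda>N. prob {\<omega> \<in> space P. y \<le> (norm (Z N \<omega>))\<^sup>2}) \<longlonglongrightarrow> 1 - cdf (chi_square CARD('l)) y" for y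
      by (rule norm_sq_tendsto_chi_square[OF Z_meas char])
    show "isCont (\<lambda>y. 1 - cdf (chi_square CARD('l)) y) q"
      using C.isCont_cdf atomless by (intro continuous_intros) auto
    show "\<forall>\<^sub>F N in sequentially. {\<omega> \<in> space P. sample \<xi> N \<omega> \<in> R N} \<in> events"
      using eventually_ge_at_top[of 1]
    proof eventually_elim
      case (elim N)
      have RN: "R N \<in> sets (PiM {1..N} (\<lambda>_. X))"
        using test[OF elim] by (simp add: is_rejection_region_def)
      show ?case
        using measurable_sets[OF sample_meas[OF elim] RN] by (simp add: vimage_def Int_def conj_commute)
    qed
    fix \<epsilon> e :: real
    assume \<epsilon>: "0 < \<epsilon>" and e: "0 < e"
    \<comment> \<open>One third of \<open>e\<close> for each source of failure: a large scaled
      error, inaccurate first moments, inaccurate second moments. Half of \<epsilon> leaves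
      \<open>s_hat\<close> strictly above \<open>q\<close> when the squared norm is at least
      \<open>q + \<epsilon>\<close>, as rejection is a strict inequality.\<close>
    then have e3: "0 < e / 3" and \<epsilon>2: "0 < \<epsilon> / 2"
      by auto
    obtain K where K: "\<forall>\<^sub>F N in sequentially. prob {\<omega> \<in> space P. K < norm (mix.err N \<omega>)} \<le> e / 3"
      using mix.err_tight[OF \<Gamma> S e3] by blast
    obtain U where U: "open U" "gbar \<in> U" "\<And>y. y \<in> U \<Longrightarrow> T differentiable (at y)"
      "continuous_on U (\<lambda>y. jacobian T (at y))"
      using T'_cont by blast
    obtain \<eta> N0 where \<eta>: "0 < \<eta>" and approx: "\<And>N x. N0 \<le> N \<Longrightarrow>
      norm (sqrt (real N) *\<^sub>R (g_hat \<iota> blk p g N x - gbar)) \<le> K \<Longrightarrow>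
      (\<And>k m. dist (block_vec blk k (e1 N m x)) (block_vec blk k (moment1 (F m) g)) \<le> \<eta>) \<Longrightarrow>
      (\<And>k l m. dist (block_mat blk k l (e2 N m x)) (block_mat blk k l (moment2 (F m) g)) \<le> \<eta>) \<Longrightarrow>
      T differentiable (at (diag_stack \<iota> blk (\<lambda>m. e1 N m x))) \<and> invertible (D_hat \<iota> blk p T e1 e2 N x) \<and>
      (let u = A *v (sqrt (real N) *\<^sub>R (g_hat \<iota> blk p g N x - gbar))
       in \<bar>s_hat \<iota> blk p g T e1 e2 N x - u \<bullet> (matrix_inv Dm *v u)\<bar> \<le> \<epsilon> / 2)"
      using s_hat_approx[of T \<iota> blk "\<lambda>m. moment1 (F m) g" U p a b "\<lambda>m. moment2 (F m) g" "\<epsilon> / 2" g K e1 e2,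
          folded gbar_def \<Sigma>_def A_def Dm_def, OF T_diff H0 U a b inv \<epsilon>2]
      by blast
    define B1 where "B1 N = {\<omega> \<in> space P. K < norm (mix.err N \<omega>)}" for N
    define B2 where "B2 N km = {\<omega> \<in> space P. dist (block_vec blk (fst km) (e1 N (snd km) (sample \<xi> N \<omega>)))
      (block_vec blk (fst km) (moment1 (F (snd km)) g)) > \<eta>}" for N km
    define B3 where "B3 N klm = {\<omega> \<in> space P. dist (block_mat blk (fst klm) (fst (snd klm)) (e2 N (snd (snd klm)) (sample \<xi> N \<omega>)))
      (block_mat blk (fst klm) (fst (snd klm)) (moment2 (F (snd (snd klm))) g)) > \<eta>}" for N klm
    \<comment> \<open>Pairs and triples over finite types index the consistency statements, so a
      finite union bound combines them.\<close>
    have "(\<lambda>N. prob (B2 N km)) \<longlonglongrightarrow> 0" for km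
      using consistent(2) \<eta> unfolding tendsto_in_prob_def B2_def by blast
    then have lim2: "(\<lambda>N. \<Sum>km\<in>UNIV. prob (B2 N km)) \<longlonglongrightarrow> 0"
      by (intro tendsto_null_sum)
    have "(\<lambda>N. prob (B3 N klm)) \<longlonglongrightarrow> 0" for klm
      using consistent(3) \<eta> unfolding tendsto_in_prob_def B3_def by blast
    then have lim3: "(\<lambda>N. \<Sum>klm\<in>UNIV. prob (B3 N klm)) \<longlonglongrightarrow> 0"
      by (intro tendsto_null_sum)
    show "\<forall>\<^sub>F N in sequentially. \<exists>B\<in>events. prob B \<le> e \<and> (\<forall>\<omega>\<in>space P - B.
        (\<omega> \<in> {\<omega> \<in> space P. sample \<xi> N \<omega> \<in> R N} \<longrightarrow> q - \<epsilon> \<le> (norm (Z N \<omega>))\<^sup>2) \<and>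
        (q + \<epsilon> \<le> (norm (Z N \<omega>))\<^sup>2 \<longrightarrow> \<omega> \<in> {\<omega> \<in> space P. sample \<xi> N \<omega> \<in> R N}))"
      using K order_tendstoD(2)[OF lim2 e3] order_tendstoD(2)[OF lim3 e3]
        eventually_ge_at_top[of N0] eventually_ge_at_top[of 1]
    proof eventually_elim
      case (elim N)
      have B1: "B1 N \<in> events"
        unfolding B1_def using mix.err_measurable[of N] by measurable
      have "(\<lambda>\<omega>. block_vec blk k (e1 N m (sample \<xi> N \<omega>))) \<in> borel_measurable P" for k m
        by (intro measurable_compose[OF measurable_compose[OF sample_meas[OF elim(5)] e1[OF elim(5)]]]
            borel_measurable_continuous_onI continuous_on_block_vec)
      then have B2: "B2 N km \<in> events" for km
        unfolding B2_def by measurable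
      have "(\<lambda>\<omega>. block_mat blk k l (e2 N m (sample \<xi> N \<omega>))) \<in> borel_measurable P" for k l m
        by (intro measurable_compose[OF measurable_compose[OF sample_meas[OF elim(5)] e2[OF elim(5)]]]
            borel_measurable_continuous_onI continuous_on_block_mat)
      then have B3: "B3 N klm \<in> events" for klm
        unfolding B3_def by measurable
      define B where "B = B1 N \<union> ((\<Union>km. B2 N km) \<union> (\<Union>klm. B3 N klm))"
      have B: "B \<in> events"
        unfolding B_def using B1 B2 B3 by (intro sets.Un sets.finite_UN) auto
      have "prob B \<le> prob (B1 N) + (prob (\<Union>km. B2 N km) + prob (\<Union>klm. B3 N klm))"
        unfolding B_def using B1 B2 B3
        by (intro order_trans[OF measure_Un_le] add_left_mono measure_Un_le sets.Un sets.finite_UN) auto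
      also have "\<dots> \<le> prob (B1 N) + ((\<Sum>km\<in>UNIV. prob (B2 N km)) + (\<Sum>klm\<in>UNIV. prob (B3 N klm)))"
        using B2 B3 by (intro add_left_mono add_mono measure_UNION_le) auto
      also have "\<dots> \<le> e"
        using elim(1-3) unfolding B1_def by linarith
      finally have "prob B \<le> e" .
      moreover have "(sample \<xi> N \<omega> \<in> R N \<longrightarrow> q - \<epsilon> \<le> (norm (Z N \<omega>))\<^sup>2) \<and>
          (q + \<epsilon> \<le> (norm (Z N \<omega>))\<^sup>2 \<longrightarrow> sample \<xi> N \<omega> \<in> R N)" if \<omega>: "\<omega> \<in> space P - B" for \<omega>
      proof -
        let ?x = "sample \<xi> N \<omega>"
        have x: "?x \<in> space (PiM {1..N} (\<lambda>_. X))"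
          using measurable_space[OF sample_meas[OF elim(5)]] \<omega> by blast
        have err: "mix.err N \<omega> = sqrt (real N) *\<^sub>R (g_hat \<iota> blk p g N ?x - gbar)"
          by (simp add: mix.err_def moment_vec)
        have 1: "norm (sqrt (real N) *\<^sub>R (g_hat \<iota> blk p g N ?x - gbar)) \<le> K"
          using \<omega> unfolding B_def B1_def err[symmetric] by auto
        have 2: "dist (block_vec blk k (e1 N m ?x)) (block_vec blk k (moment1 (F m) g)) \<le> \<eta>" for k m
        proof -
          have "\<omega> \<notin> B2 N (k, m)"
            using \<omega> by (auto simp: B_def)
          then show ?thesis
            using \<omega> by (simp add: B2_def)
        qed
        have 3: "dist (block_mat blk k l (e2 N m ?x)) (block_mat blk k l (moment2 (F m) g)) \<le> \<eta>" for k l m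
        proof -
          have "\<omega> \<notin> B3 N (k, l, m)"
            using \<omega> by (auto simp: B_def)
          then show ?thesis
            using \<omega> by (simp add: B3_def)
        qed
        have good: "T differentiable (at (diag_stack \<iota> blk (\<lambda>m. e1 N m ?x)))"
          "invertible (D_hat \<iota> blk p T e1 e2 N ?x)"
          "\<bar>s_hat \<iota> blk p g T e1 e2 N ?x - (norm (Z N \<omega>))\<^sup>2\<bar> \<le> \<epsilon> / 2"
          using approx[OF elim(4) 1 2 3] unfolding Z_sq err Let_def by blast+
        \<comment> \<open>Outside \<open>B\<close> the derivative exists and \<open>D_hat\<close> is
          invertible, so the arbitrary convention never decides.\<close>
        have "?x \<in> R N \<longleftrightarrow> \<not> s_hat \<iota> blk p g T e1 e2 N ?x \<le> q"
          using test[OF elim(5)] x good(1,2) unfolding is_rejection_region_def q_def by blast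
        then show ?thesis
          using good(3) \<epsilon> by linarith
      qed
      ultimately show ?case
        using B by (intro bexI[of _ B]) auto
    qed
  qed
  ultimately show ?thesis
    by simp
qed

end
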